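(* Let $X$ and $J$ be finite and let $f\in\mathcal L(X,J)$ be a generative formula. Then there is a continuum of cells of $\Omega(X,J)$ with finite fanout that are dense in $\mathbf{Ck}(\{f\})$.
   Context: Formulas. $X$ (primitive propositions) and $J$ (agents) are finite sets. $\mathcal L=\mathcal L(X,J)$ is the smallest set of formulas containing $X$ and closed under $g\mapsto\neg g$, $(g,h)\mapsto g\wedge h$, and $g\mapsto k_jg$ for $j\in J$; $g\vee h$ and $g\to h$ are the usual abbreviations ($g\to h$ is $\neg g\vee h$). The multi-agent S5 logic has the rules modus ponens and necessitation (if $g$ is a theorem so is $k_jg$) and as axioms all substitution instances of propositional theorems, $(k_jg\wedge k_j(g\to h))\to k_jh$, $k_jg\to g$, $k_jg\to k_jk_jg$, $\neg k_jg\to k_j\neg k_jg$. A set of formulas is consistent if no finite subset leads to a contradiction in this logic, and complete if for each formula $g$ it contains $g$ or $\neg g$. $\Omega=\Omega(X,J)$ is the set of all complete and consistent subsets of $\mathcal L$. Partitions, cells, topology. For $j\in J$, $\mathcal Q^j$ is the partition of $\Omega$ in which $z,z'$ are equivalent iff $\{g: k_jg\in z\}=\{g:k_jg\in z'\}$. A possibility set is a member of some $\mathcal Q^j$. A cell is a member of the meet partition $\bigwedge_{j\in J}\mathcal Q^j$, i.e. a minimal non-empty $C\subseteq\Omega$ such that $P\in\mathcal Q^j$ and $P\cap C\neq\emptyset$ imply $P\subseteq C$, for all $j$. A cell has finite fanout if every possibility set contained in it is finite. The topology of $\Omega$ has as base the sets $\{z\in\Omega: g\in z\}$, $g\in\mathcal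 L$. Let $E^0g=g$, $E g=\bigwedge_{j\in J}k_jg$, $E^{n}g=E(E^{n-1}g)$, and $\mathbf{Ck}(\{f\})=\{z\in\Omega: E^nf\in z\text{ for all }n\ge 0\}$. A cell $C$ is dense in $\mathbf{Ck}(\{f\})$ if $C\subseteq \mathbf{Ck}(\{f\})$ and $C$ is dense in it in the relative topology. Finite levels. Depth: $\mathrm{depth}(x)=0$ for $x\in X$, $\mathrm{depth}(\neg g)=\mathrm{depth}(g)$, $\mathrm{depth}(g\wedge h)=\max(\mathrm{depth}(g),\mathrm{depth}(h))$, $\mathrm{depth}(k_jg)=\mathrm{depth}(g)+1$. $\mathcal L_i$ is the set of formulas of depth $\le i$; $\Omega_i$ is the (finite) set of maximally consistent subsets of $\mathcal L_i$; $\pi_i:\Omega\to\Omega_i$, $\pi_i(z)=z\cap\mathcal L_i$ (surjective). $\mathcal G_i=\{\pi_i^{-1}(w):w\in\Omega_i\}$. For $i\ge1$, $\overline{\mathcal F}_i^j$ is the partition of $\Omega_i$ in which $w,w'$ are equivalent iff $\{g\in\mathcal L_{i-1}:k_jg\in w\}=\{g\in\mathcal L_{i-1}:k_jg\in w'\}$; $\overline{\mathcal F}_0^j=\{\Omega_0\}$; $\mathcal F_i^j=\{\pi_i^{-1}(B):B\in\overline{\mathcal F}_i^j\}$. For a formula $f$ of depth $d$, $\alpha^{\Omega_d}(f)=\{w\in\Omega_d:f\in w\}$. Generative formulas. For $i>0$ a non-empty $A\subseteq\Omega_i$ is semantically closed if for all $j\in J$, $B\in\mathcal G_{i-1}$,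 $w\in A$: if $\pi_i^{-1}(w)\subseteq F\in\mathcal F_i^j$ and $F\cap B\ne\emptyset$ then $F\cap B\cap\pi_i^{-1}(A)\neq\emptyset$. Every non-empty subset of $\Omega_0$ is semantically closed. A subset $A\subseteq\Omega_d$ is connected if any two of its elements are joined by a finite sequence in $A$ in which consecutive elements share a member of $\overline{\mathcal F}_d^j$ for some $j\in J$. A formula $f$ with $d=\mathrm{depth}(f)$ and $|J|\ge2$ is generative if $\alpha^{\Omega_d}(f)$ is semantically closed and connected, and there exists more than one cell dense in $\mathbf{Ck}(\{f\})$. *)

theory Defs
  imports "HOL-Analysis.Analysis" "HOL-Library.Equipollence"
begin

text \<open>The finite sets \<open>X\<close> of primitive propositions and \<open>J\<close> of agents are the
  types \<open>'x::finite\<close> and \<open>'j::finite\<close>, so that the type \<open>('x, 'j) fm\<close> is all of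
  \<open>\<L>(X, J)\<close>. Types are non-empty, but if \<open>X\<close> is empty then so is \<open>\<L>(X, J)\<close>, and
  generative formulas exist only for at least two agents.\<close>

datatype ('x, 'j) fm =
    Atom 'x
  | Neg "('x, 'j) fm"
  | And "('x, 'j) fm" "('x, 'j) fm"
  | K 'j "('x, 'j) fm"

abbreviation Or :: "('x, 'j) fm \<Rightarrow> ('x, 'j) fm \<Rightarrow> ('x, 'j) fm" where
  "Or g h \<equiv> Neg (And (Neg g) (Neg h))"

abbreviation Imp :: "('x, 'j) fm \<Rightarrow> ('x, 'j) fm \<Rightarrow> ('x, 'j) fm" where
  "Imp g h \<equiv> Or (Neg g) h"

primrec depth :: "('x, 'j) fm \<Rightarrow> nat" where
  "depth (Atom x) = 0"
| "depth (Neg g) = depth g"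
| "depth (And g h) = max (depth g) (depth h)"
| "depth (K j g) = depth g + 1"

text \<open>Propositional formulas have countably many variables here, independently of the
  number of primitive propositions: otherwise there would be too few substitution
  instances of propositional theorems.\<close>

datatype pfm = PVar nat | PNeg pfm | PAnd pfm pfm

primrec peval :: "(nat \<Rightarrow> bool) \<Rightarrow> pfm \<Rightarrow> bool" where
  "peval v (PVar n) = v n"
| "peval v (PNeg p) = (\<not> peval v p)"
| "peval v (PAnd p q) = (peval v p \<and> peval v q)"

definition tautology :: "pfm \<Rightarrow> bool" where
  "tautology p \<longleftrightarrow> (\<forall>v. peval v p)"

primrec psubst :: "(nat \<Rightarrow> ('x, 'j) fm) \<Rightarrow> pfm \<Rightarrow> ('x, 'j) fm" where
  "psubst \<sigma> (PVar n) = \<sigma> n"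
| "psubst \<sigma> (PNeg p) = Neg (psubst \<sigma> p)"
| "psubst \<sigma> (PAnd p q) = And (psubst \<sigma> p) (psubst \<sigma> q)"

inductive S5 :: "('x, 'j) fm \<Rightarrow> bool" where
  Taut: "tautology p \<Longrightarrow> S5 (psubst \<sigma> p)"
| AxK: "S5 (Imp (And (K j g) (K j (Imp g h))) (K j h))"
| AxT: "S5 (Imp (K j g) g)"
| Ax4: "S5 (Imp (K j g) (K j (K j g)))"
| Ax5: "S5 (Imp (Neg (K j g)) (K j (Neg (K j g))))"
| MP: "S5 g \<Longrightarrow> S5 (Imp g h) \<Longrightarrow> S5 h"
| Nec: "S5 g \<Longrightarrow> S5 (K j g)"

text \<open>Deduction from assumptions: necessitation applies to theorems only, not to
  consequences of the assumptions.\<close>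

inductive derives :: "('x, 'j) fm set \<Rightarrow> ('x, 'j) fm \<Rightarrow> bool" for S where
  Assm: "g \<in> S \<Longrightarrow> derives S g"
| Thm: "S5 g \<Longrightarrow> derives S g"
| DMP: "derives S g \<Longrightarrow> derives S (Imp g h) \<Longrightarrow> derives S h"

definition consistent :: "('x, 'j) fm set \<Rightarrow> bool" where
  "consistent S \<longleftrightarrow>
     \<not> (\<exists>F. finite F \<and> F \<subseteq> S \<and> (\<exists>g. derives F g \<and> derives F (Neg g)))"

definition complete_fms :: "('x, 'j) fm set \<Rightarrow> bool" where
  "complete_fms S \<longleftrightarrow> (\<forall>g. g \<in> S \<or> Neg g \<in> S)"

definition Omega :: "('x, 'j) fm set set" where
  "Omega = {z. complete_fms z \<and> consistent z}"

definition Q :: "'j \<Rightarrow> ('x, 'j) fm set set set" where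
  "Q j = Omega // {(z, z'). z \<in> Omega \<and> z' \<in> Omega \<and> {g. K j g \<in> z} = {g. K j g \<in> z'}}"

definition possibility_set :: "('x, 'j) fm set set \<Rightarrow> bool" where
  "possibility_set P \<longleftrightarrow> (\<exists>j. P \<in> Q j)"

definition saturated :: "('x, 'j) fm set set \<Rightarrow> bool" where
  "saturated C \<longleftrightarrow> C \<subseteq> Omega \<and> (\<forall>j. \<forall>P \<in> Q j. P \<inter> C \<noteq> {} \<longrightarrow> P \<subseteq> C)"

definition cell :: "('x, 'j) fm set set \<Rightarrow> bool" where
  "cell C \<longleftrightarrow> saturated C \<and> C \<noteq> {} \<and>
     (\<forall>D. saturated D \<and> D \<noteq> {} \<and> D \<subseteq> C \<longrightarrow> D = C)"

definition finite_fanout :: "('x, 'j) fm set set \<Rightarrow> bool" where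
  "finite_fanout C \<longleftrightarrow> (\<forall>P. possibility_set P \<and> P \<subseteq> C \<longrightarrow> finite P)"

text \<open>The generating family covers \<open>Omega\<close> and is closed under finite intersections
  (\<open>And\<close>), so it is a base of the topology that it generates.\<close>

definition Omega_top :: "('x, 'j) fm set topology" where
  "Omega_top = topology_generated_by {{z \<in> Omega. g \<in> z} | g. True}"

text \<open>Conjunction over a non-empty list. The agents are listed in some fixed order; any
  two orders give logically equivalent formulas.\<close>

fun Conj :: "('x, 'j) fm list \<Rightarrow> ('x, 'j) fm" where
  "Conj [] = undefined"
| "Conj [g] = g"
| "Conj (g # h # gs) = And g (Conj (h # gs))"

definition agents :: "'j::finite list" where
  "agents = (SOME js. distinct js \<and> set js = UNIV)"

definition E :: "('x, 'j::finite) fm \<Rightarrow> ('x, 'j) fm" where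
  "E g = Conj (map (\<lambda>j. K j g) agents)"

definition Ck :: "('x, 'j::finite) fm \<Rightarrow> ('x, 'j) fm set set" where
  "Ck f = {z \<in> Omega. \<forall>n. (E ^^ n) f \<in> z}"

definition dense_in_Ck :: "('x, 'j::finite) fm set set \<Rightarrow> ('x, 'j) fm \<Rightarrow> bool" where
  "dense_in_Ck C f \<longleftrightarrow> C \<subseteq> Ck f \<and> subtopology Omega_top (Ck f) closure_of C = Ck f"

definition L_lev :: "nat \<Rightarrow> ('x, 'j) fm set" where
  "L_lev i = {g. depth g \<le> i}"

definition Omega_lev :: "nat \<Rightarrow> ('x, 'j) fm set set" where
  "Omega_lev i = {w. w \<subseteq> L_lev i \<and> consistent w \<and>
     (\<forall>w'. w' \<subseteq> L_lev i \<and> consistent w' \<and> w \<subseteq> w' \<longrightarrow> w' = w)}"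

definition proj :: "nat \<Rightarrow> ('x, 'j) fm set \<Rightarrow> ('x, 'j) fm set" where
  "proj i z = z \<inter> L_lev i"

definition preim :: "nat \<Rightarrow> ('x, 'j) fm set set \<Rightarrow> ('x, 'j) fm set set" where
  "preim i A = {z \<in> Omega. proj i z \<in> A}"

definition G :: "nat \<Rightarrow> ('x, 'j) fm set set set" where
  "G i = {preim i {w} | w. w \<in> Omega_lev i}"

definition Fbar :: "nat \<Rightarrow> 'j \<Rightarrow> ('x, 'j) fm set set set" where
  "Fbar i j = (if i = 0 then {Omega_lev 0}
     else Omega_lev i // {(w, w'). w \<in> Omega_lev i \<and> w' \<in> Omega_lev i \<and>
       {g \<in> L_lev (i - 1). K j g \<in> w} = {g \<in> L_lev (i - 1). K j g \<in> w'}})"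

definition F :: "nat \<Rightarrow> 'j \<Rightarrow> ('x, 'j) fm set set set" where
  "F i j = {preim i B | B. B \<in> Fbar i j}"

definition alpha :: "nat \<Rightarrow> ('x, 'j) fm \<Rightarrow> ('x, 'j) fm set set" where
  "alpha d f = {w \<in> Omega_lev d. f \<in> w}"

definition semantically_closed :: "nat \<Rightarrow> ('x, 'j) fm set set \<Rightarrow> bool" where
  "semantically_closed i A \<longleftrightarrow> A \<noteq> {} \<and> A \<subseteq> Omega_lev i \<and>
     (i > 0 \<longrightarrow> (\<forall>j. \<forall>B \<in> G (i - 1). \<forall>w \<in> A. \<forall>S \<in> F i j.
        preim i {w} \<subseteq> S \<and> S \<inter> B \<noteq> {} \<longrightarrow> S \<inter> B \<inter> preim i A \<noteq> {}))"

definition connected_lev :: "nat \<Rightarrow> ('x, 'j) fm set set \<Rightarrow> bool" where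
  "connected_lev d A \<longleftrightarrow> (\<forall>w \<in> A. \<forall>w' \<in> A.
     (w, w') \<in> {(u, v). u \<in> A \<and> v \<in> A \<and> (\<exists>j. \<exists>B \<in> Fbar d j. u \<in> B \<and> v \<in> B)}\<^sup>*)"

definition generative :: "('x, 'j::finite) fm \<Rightarrow> bool" where
  "generative f \<longleftrightarrow> CARD('j) \<ge> 2 \<and>
     semantically_closed (depth f) (alpha (depth f) f) \<and>
     connected_lev (depth f) (alpha (depth f) f) \<and>
     (\<exists>C C'. cell C \<and> cell C' \<and> C \<noteq> C' \<and> dense_in_Ck C f \<and> dense_in_Ck C' f)"

end

theory Submission
  imports Defs
begin

text \<open>Neither density nor finite fanout passes to limits, so each is replaced by conditions
  that do. A bound on the possibility sets within a fixed distance is closed. That a cell meets a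
  given formula is decided by finitely many depths, since a path to a state with that formula lifts
  to every state that agrees deeply enough. Hence stage \<open>k\<close> keeps all bounds at
  distances up to \<open>k\<close> and secures one further formula.

  The delicate point is that the theory of a distant state really changes. The new state imitates
  \<open>p\<close> for one agent and, for the others, a state \<open>y\<close> that agrees with
  \<open>p\<close> to depth \<open>n\<close> but not to depth \<open>n + 1\<close>. It therefore has
  the type of \<open>p\<close> to depth \<open>n\<close>, while some agent's knowledge one level
  higher is that of \<open>y\<close>; and \<open>n\<close> is large enough to separate all states
  near a path from the given state to \<open>p\<close>. Density survives because a formula that
  occurs in the set of common knowledge occurs at infinitely many states of a dense cell, and all
  but finitely many of them are too far from \<open>p\<close> to be affected at its depth.\<close>

text \<open>Two distinct dense cells are disjoint, so the set of common knowledge has no isolated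
  point. Chaining finite models of increasing depth gives one dense cell with finite fanout. Far
  away from a given point of such a cell one can enlarge a possibility set by a new state,
  attached to a second copy of the cell, so that the theory of the given point changes, but
  neither its formulas of small depth nor the sizes of nearby possibility sets do. Iterating this
  along infinite binary sequences, while more and more formulas are met within a bounded
  distance, gives a continuum of limit points. Their cells are still dense and have finite fanout,
  hence are countable, so there is a continuum of them.\<close>

section \<open>Maximal consistent sets\<close>

context
  fixes a b c :: "('x, 'j) fm"
begin

private abbreviation pimp :: "pfm \<Rightarrow> pfm \<Rightarrow> pfm" where
  "pimp p q \<equiv> PNeg (PAnd (PNeg (PNeg p)) (PNeg q))"

private abbreviation pa :: pfm where "pa \<equiv> PVar 0"
private abbreviation pb :: pfm where "pb \<equiv> PVar (Suc 0)"
private abbreviation pc :: pfm where "pc \<equiv> PVar (Suc (Suc 0))"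

private lemma S5_inst: "tautology p \<Longrightarrow> S5 (psubst (\<lambda>n. [a, b, c] ! n) p)"
  by (rule Taut)

lemma S5_refl: "S5 (Imp a a)"
  using S5_inst[of "pimp pa pa"] by (simp add: tautology_def)

lemma S5_weaken: "S5 (Imp b (Imp a b))"
  using S5_inst[of "pimp pb (pimp pa pb)"] by (simp add: tautology_def)

lemma S5_distrib: "S5 (Imp (Imp a (Imp b c)) (Imp (Imp a b) (Imp a c)))"
  using S5_inst[of "pimp (pimp pa (pimp pb pc)) (pimp (pimp pa pb) (pimp pa pc))"]
  by (simp add: tautology_def)

lemma S5_reductio: "S5 (Imp (Imp (Neg a) b) (Imp (Imp (Neg a) (Neg b)) a))"
  using S5_inst[of "pimp (pimp (PNeg pa) pb) (pimp (pimp (PNeg pa) (PNeg pb)) pa)"]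
  by (simp add: tautology_def) blast

lemma S5_negI: "S5 (Imp (Imp a b) (Imp (Imp a (Neg b)) (Neg a)))"
  using S5_inst[of "pimp (pimp pa pb) (pimp (pimp pa (PNeg pb)) (PNeg pa))"]
  by (simp add: tautology_def) blast

lemma S5_conjD1: "S5 (Imp (And a b) a)"
  using S5_inst[of "pimp (PAnd pa pb) pa"] by (simp add: tautology_def)

lemma S5_conjD2: "S5 (Imp (And a b) b)"
  using S5_inst[of "pimp (PAnd pa pb) pb"] by (simp add: tautology_def)

lemma S5_conjI: "S5 (Imp a (Imp b (And a b)))"
  using S5_inst[of "pimp pa (pimp pb (PAnd pa pb))"] by (simp add: tautology_def)

end

section \<open>Derivability, consistency and maximal extensions\<close>

lemma derives_mono: "derives S g \<Longrightarrow> S \<subseteq> T \<Longrightarrow> derives T g"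
  by (induction rule: derives.induct) (auto intro: derives.intros)

lemma derives_finite: "derives S g \<Longrightarrow> \<exists>T. finite T \<and> T \<subseteq> S \<and> derives T g"
proof (induction rule: derives.induct)
  case (Assm g)
  then show ?case by (intro exI[of _ "{g}"]) (auto intro: derives.Assm)
next
  case (Thm g)
  then show ?case by (intro exI[of _ "{}"]) (auto intro: derives.Thm)
next
  case (DMP g h)
  then obtain T1 T2 where "finite T1" "T1 \<subseteq> S" "derives T1 g"
    "finite T2" "T2 \<subseteq> S" "derives T2 (Imp g h)" by blast
  then have "derives (T1 \<union> T2) h"
    by (meson derives.DMP derives_mono sup_ge1 sup_ge2)
  then show ?case
    using \<open>finite T1\<close> \<open>T1 \<subseteq> S\<close> \<open>finite T2\<close> \<open>T2 \<subseteq> S\<close> by (intro exI[of _ "T1 \<union> T2"]) auto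
qed

lemma consistent_iff: "consistent S \<longleftrightarrow> \<not> (\<exists>g. derives S g \<and> derives S (Neg g))"
proof -
  have "\<exists>T. finite T \<and> T \<subseteq> S \<and> (\<exists>g. derives T g \<and> derives T (Neg g))"
    if sg: "derives S g" "derives S (Neg g)" for g
  proof -
    obtain T1 where T1: "finite T1" "T1 \<subseteq> S" "derives T1 g"
      using derives_finite[OF sg(1)] by blast
    obtain T2 where T2: "finite T2" "T2 \<subseteq> S" "derives T2 (Neg g)"
      using derives_finite[OF sg(2)] by blast
    have "derives (T1 \<union> T2) g" "derives (T1 \<union> T2) (Neg g)"
      using derives_mono[OF T1(3)] derives_mono[OF T2(3)] by auto
    then show ?thesis using T1 T2 by (intro exI[of _ "T1 \<union> T2"]) auto
  qed
  then show ?thesis unfolding consistent_def by (meson derives_mono)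
qed

text \<open>The induction works because necessitation is not a rule of \<open>derives\<close>;
  theorems enter as a whole through \<open>Thm\<close>.\<close>

lemma deduction: "derives (insert a S) g \<Longrightarrow> derives S (Imp a g)"
proof (induction rule: derives.induct)
  case (Assm g)
  then show ?case
    by (metis S5_refl S5_weaken derives.Assm derives.Thm derives.DMP insertE)
next
  case (Thm g)
  then show ?case by (metis S5_weaken derives.Thm derives.DMP)
next
  case (DMP g h)
  then show ?case by (metis S5_distrib derives.Thm derives.DMP)
qed

lemma inconsistent_insert_Neg:
  assumes "\<not> consistent (insert (Neg g) S)"
  shows "derives S g"
  using assms unfolding consistent_iff
  by (metis S5_reductio deduction derives.Thm derives.DMP)

lemma inconsistent_insert:
  assumes "\<not> consistent (insert g S)"
  shows "derives S (Neg g)"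
  using assms unfolding consistent_iff
  by (metis S5_negI deduction derives.Thm derives.DMP)

lemma Omega_derives:
  assumes "z \<in> Omega" "derives z g"
  shows "g \<in> z"
proof -
  have "g \<in> z \<or> Neg g \<in> z" "consistent z"
    using assms by (auto simp: Omega_def complete_fms_def)
  then show ?thesis using assms(2) unfolding consistent_iff by (metis derives.Assm)
qed

lemma Omega_MP: "z \<in> Omega \<Longrightarrow> S5 (Imp g h) \<Longrightarrow> g \<in> z \<Longrightarrow> h \<in> z"
  by (meson Omega_derives derives.Assm derives.Thm derives.DMP)

lemma Omega_Neg [simp]: "z \<in> Omega \<Longrightarrow> Neg g \<in> z \<longleftrightarrow> g \<notin> z"
  unfolding Omega_def complete_fms_def consistent_iff using derives.Assm by blast

lemma Omega_And [simp]:
  assumes "z \<in> Omega"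
  shows "And g h \<in> z \<longleftrightarrow> g \<in> z \<and> h \<in> z"
  using assms
  by (meson Omega_MP S5_conjD1 S5_conjD2 S5_conjI Omega_derives derives.Assm derives.Thm derives.DMP)

lemma Omega_K: "z \<in> Omega \<Longrightarrow> K j g \<in> z \<Longrightarrow> g \<in> z"
  by (meson Omega_MP AxT)

lemma Omega_subset_eq:
  assumes "z \<in> Omega" "z' \<in> Omega" "z \<subseteq> z'"
  shows "z = z'"
  using assms Omega_Neg by blast

text \<open>Zorn's lemma applies since a finite contradiction in the union of a chain already lies
  in one member; a maximal consistent set is complete.\<close>

lemma consistent_extend:
  assumes "consistent S"
  obtains z where "z \<in> Omega" "S \<subseteq> z"
proof -
  let ?\<A> = "{T. consistent T \<and> S \<subseteq> T}"
  have "\<exists>M\<in>?\<A>. \<forall>X\<in>?\<A>. M \<subseteq> X \<longrightarrow> X = M"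
  proof (rule subset_Zorn_nonempty)
    show "?\<A> \<noteq> {}" using assms by blast
    fix \<C> assume \<C>: "\<C> \<noteq> {}" "subset.chain ?\<A> \<C>"
    have "consistent (\<Union>\<C>)"
      unfolding consistent_def
    proof (rule notI, elim exE conjE)
      fix T g assume T: "finite T" "T \<subseteq> \<Union>\<C>" "derives T g" "derives T (Neg g)"
      obtain U where "U \<in> \<C>" "T \<subseteq> U"
        using finite_subset_Union_chain[OF T(1,2) \<C>] by blast
      then have "consistent U" using \<C>(2) by (auto simp: subset_chain_def)
      then show False
        using \<open>T \<subseteq> U\<close> T unfolding consistent_def by blast
    qed
    moreover have "S \<subseteq> \<Union>\<C>" using \<C> unfolding subset_chain_def by fast
    ultimately show "\<Union>\<C> \<in> ?\<A>" by simp
  qed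
  then obtain M where "M \<in> ?\<A>" and max': "\<forall>X\<in>?\<A>. M \<subseteq> X \<longrightarrow> X = M"
    by (rule bexE)
  then have M: "consistent M" "S \<subseteq> M" by simp_all
  have max: "g \<in> M" if "consistent (insert g M)" for g
    using max'[rule_format, of "insert g M"] that M(2) by auto
  have "g \<in> M \<or> Neg g \<in> M" for g
  proof (rule ccontr)
    assume "\<not> (g \<in> M \<or> Neg g \<in> M)"
    then have "derives M g" "derives M (Neg g)"
      using max[of g] max[of "Neg g"] inconsistent_insert[of g M] inconsistent_insert_Neg[of g M]
      by argo+
    then show False using M(1) unfolding consistent_iff by blast
  qed
  then have "complete_fms M" unfolding complete_fms_def by (rule allI)
  then have "M \<in> Omega" using M(1) by (simp add: Omega_def)
  then show thesis using M(2) by (rule that)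
qed

section \<open>Knowledge at complete consistent sets\<close>

definition part :: "'j \<Rightarrow> ('x, 'j) fm set \<Rightarrow> ('x, 'j) fm set" where
  "part j z = {g. K j g \<in> z}"

lemma part_eqD: "part j z = part j z' \<Longrightarrow> K j g \<in> z \<longleftrightarrow> K j g \<in> z'"
  unfolding part_def by blast

lemma derives_part: "derives (part j z) h \<Longrightarrow> derives z (K j h)"
proof (induction rule: derives.induct)
  case (Assm g)
  then show ?case by (simp add: part_def derives.Assm)
next
  case (Thm g)
  then show ?case by (simp add: S5.Nec derives.Thm)
next
  case (DMP g h)
  then show ?case
    by (meson AxK S5_conjI derives.DMP derives.Thm)
qed

text \<open>Extend \<open>part j z\<close> together with \<open>Neg g\<close>. Positive
  introspection carries over what \<open>j\<close> knows at \<open>z\<close>, negative introspection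
  what \<open>j\<close> does not know, so the two parts coincide.\<close>

lemma Omega_K_exists:
  assumes z: "z \<in> Omega" and g: "K j g \<notin> z"
  obtains z' where "z' \<in> Omega" "part j z' = part j z" "g \<notin> z'"
proof -
  have "consistent (insert (Neg g) (part j z))"
    using g Omega_derives[OF z derives_part[OF inconsistent_insert_Neg, of g j z]] by argo
  then obtain z' where z': "z' \<in> Omega" "insert (Neg g) (part j z) \<subseteq> z'"
    by (rule consistent_extend)
  have "K j h \<in> z'" if "K j h \<in> z" for h
    using Omega_MP[OF z Ax4 that] z'(2) by (auto simp: part_def)
  moreover have "K j h \<notin> z'" if "K j h \<notin> z" for h
  proof -
    have "K j (Neg (K j h)) \<in> z" using Omega_MP[OF z Ax5, of j h] that z by simp
    then have "Neg (K j h) \<in> z'" using z'(2) by (auto simp: part_def)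
    then show ?thesis using z' by simp
  qed
  ultimately have "part j z' = part j z" by (auto simp: part_def)
  then show thesis using that z' by simp
qed

text \<open>The truth lemma of the canonical model, with the possibility sets as
  accessibility.\<close>

lemma Omega_K_iff:
  assumes "z \<in> Omega"
  shows "K j g \<in> z \<longleftrightarrow> (\<forall>z'\<in>Omega. part j z' = part j z \<longrightarrow> g \<in> z')"
proof
  assume "K j g \<in> z"
  then show "\<forall>z'\<in>Omega. part j z' = part j z \<longrightarrow> g \<in> z'"
    using Omega_K part_eqD by metis
next
  assume "\<forall>z'\<in>Omega. part j z' = part j z \<longrightarrow> g \<in> z'"
  then show "K j g \<in> z" using Omega_K_exists[OF assms, of j g] by metis
qed

lemma finite_Conj_ex:
  fixes S :: "('x, 'j) fm set"
  assumes "finite S"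
  shows "\<exists>g. (\<forall>z\<in>Omega. g \<in> z \<longleftrightarrow> S \<subseteq> z) \<and> (\<forall>n. (\<forall>h\<in>S. depth h \<le> n) \<longrightarrow> depth g \<le> n)"
  using assms
proof induction
  case empty
  show ?case
    \<comment> \<open>A tautology of depth 0 serves as the empty conjunction, on which
      \<open>Conj\<close> is unspecified.\<close>
    by (rule exI[of _ "Neg (And (Atom undefined) (Neg (Atom undefined)))"]) auto
next
  case (insert h S)
  then obtain g where "\<forall>z\<in>Omega. g \<in> z \<longleftrightarrow> S \<subseteq> z"
    "\<forall>n. (\<forall>h\<in>S. depth h \<le> n) \<longrightarrow> depth g \<le> n" by blast
  then show ?case by (intro exI[of _ "And h g"]) auto
qed

section \<open>Agreement up to a given depth\<close>

text \<open>On \<open>Omega\<close>, its classes are the members of \<open>G n\<close>.\<close>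

definition agree :: "nat \<Rightarrow> ('x, 'j) fm set \<Rightarrow> ('x, 'j) fm set \<Rightarrow> bool" where
  "agree n z z' \<longleftrightarrow> (\<forall>g. depth g \<le> n \<longrightarrow> (g \<in> z \<longleftrightarrow> g \<in> z'))"

lemma agree_refl [simp]: "agree n z z"
  by (simp add: agree_def)

lemma agree_sym: "agree n z z' \<Longrightarrow> agree n z' z"
  by (simp add: agree_def)

lemma agree_trans: "agree n z z' \<Longrightarrow> agree n z' z'' \<Longrightarrow> agree n z z''"
  by (simp add: agree_def)

lemma agree_mono: "agree n z z' \<Longrightarrow> m \<le> n \<Longrightarrow> agree m z z'"
  by (simp add: agree_def)

lemma agreeD: "agree n z z' \<Longrightarrow> depth g \<le> n \<Longrightarrow> g \<in> z \<longleftrightarrow> g \<in> z'"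
  by (simp add: agree_def)

text \<open>Every formula is a Boolean combination of atoms and formulas
  \<open>K j h\<close>.\<close>

lemma agreeI_modal:
  assumes "z \<in> Omega" "z' \<in> Omega"
    and atoms: "\<And>x. Atom x \<in> z \<longleftrightarrow> Atom x \<in> z'"
    and modal: "\<And>j h. depth h < n \<Longrightarrow> K j h \<in> z \<longleftrightarrow> K j h \<in> z'"
  shows "agree n z z'"
proof -
  have "depth g \<le> n \<longrightarrow> (g \<in> z \<longleftrightarrow> g \<in> z')" for g
    using assms by (induction g) auto
  then show ?thesis by (simp add: agree_def)
qed

lemma not_agree_ex:
  assumes "z \<in> Omega" "z' \<in> Omega" "z \<noteq> z'"
  shows "\<exists>n. \<not> agree n z z'"
  using assms unfolding agree_def by (metis order_refl set_eqI)

lemma separating_level: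
  assumes "finite S" "S \<subseteq> Omega"
  shows "\<exists>n\<ge>m. \<forall>z\<in>S. \<forall>z'\<in>S. agree n z z' \<longrightarrow> z = z'"
proof -
  have "\<forall>p\<in>S \<times> S. \<exists>n. fst p \<noteq> snd p \<longrightarrow> \<not> agree n (fst p) (snd p)"
    using assms(2) not_agree_ex by fastforce
  then obtain N where N: "\<And>z z'. z \<in> S \<Longrightarrow> z' \<in> S \<Longrightarrow> z \<noteq> z' \<Longrightarrow> \<not> agree (N (z, z')) z z'"
    by (metis (no_types, lifting) SigmaI bchoice fst_conv snd_conv)
  \<comment> \<open>Inserting \<open>m\<close> gives the lower bound and keeps the set
    non-empty.\<close>
  define n where "n = Max (insert m (N ` (S \<times> S)))"
  have fin: "finite (insert m (N ` (S \<times> S)))" using assms(1) by simp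
  have "m \<le> n" unfolding n_def using fin by (intro Max_ge) auto
  moreover have "z = z'" if "z \<in> S" "z' \<in> S" "agree n z z'" for z z'
  proof -
    have "N (z, z') \<le> n" unfolding n_def using fin that by (intro Max_ge) auto
    then show ?thesis using N that agree_mono by blast
  qed
  ultimately show ?thesis by blast
qed

lemma test_conjunction:
  assumes \<Phi>: "finite \<Phi>" "\<forall>g\<in>\<Phi>. depth g \<le> n" and S: "S \<subseteq> \<Phi>"
  shows "\<exists>g. depth g \<le> n \<and> (\<forall>z\<in>Omega. g \<in> z \<longleftrightarrow> z \<inter> \<Phi> = S)"
proof -
  let ?T = "S \<union> Neg ` (\<Phi> - S)"
  have fin: "finite ?T" using \<Phi>(1) S finite_subset by auto
  obtain g where g: "\<forall>z\<in>Omega. g \<in> z \<longleftrightarrow> ?T \<subseteq> z"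
    and dep: "\<forall>n. (\<forall>h\<in>?T. depth h \<le> n) \<longrightarrow> depth g \<le> n"
    using finite_Conj_ex[OF fin] by (elim exE conjE)
  have "?T \<subseteq> z \<longleftrightarrow> z \<inter> \<Phi> = S" if "z \<in> Omega" for z
  proof -
    have "Neg ` (\<Phi> - S) \<subseteq> z \<longleftrightarrow> (\<forall>g\<in>\<Phi> - S. g \<notin> z)"
      using that by (simp add: image_subset_iff)
    then show ?thesis using S by auto
  qed
  then have "\<forall>z\<in>Omega. g \<in> z \<longleftrightarrow> z \<inter> \<Phi> = S" using g by simp
  moreover have "\<forall>h\<in>?T. depth h \<le> n" using \<Phi>(2) S by auto
  then have "depth g \<le> n" using dep by simp
  ultimately show ?thesis by (intro exI[of _ g] conjI)
qed

text \<open>There are finitely many types of each depth. The induction step records, for each agent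
  and each pattern on the old test set, whether that agent considers the pattern possible.\<close>

lemma finite_test_set:
  "\<exists>\<Phi>. finite \<Phi> \<and> (\<forall>g\<in>\<Phi>. depth g \<le> n) \<and>
     (\<forall>z\<in>Omega. \<forall>z'\<in>Omega. z \<inter> \<Phi> = z' \<inter> \<Phi> \<longrightarrow> agree n z (z' :: ('x::finite, 'j::finite) fm set))"
proof (induction n)
  case 0
  show ?case
  proof (intro exI[of _ "range Atom"] conjI ballI impI)
    fix z z' :: "('x, 'j) fm set"
    assume "z \<in> Omega" "z' \<in> Omega" "z \<inter> range Atom = z' \<inter> range Atom"
    then show "agree 0 z z'" by (intro agreeI_modal) auto
  qed auto
next
  case (Suc n)
  then obtain \<Phi> :: "('x, 'j) fm set" where fin: "finite \<Phi>" and dep: "\<forall>g\<in>\<Phi>. depth g \<le> n"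
    and agr: "\<forall>z\<in>Omega. \<forall>z'\<in>Omega. z \<inter> \<Phi> = z' \<inter> \<Phi> \<longrightarrow> agree n z z'" by (elim exE conjE)
  have "\<forall>S\<in>Pow \<Phi>. \<exists>g. depth g \<le> n \<and> (\<forall>z\<in>Omega. g \<in> z \<longleftrightarrow> z \<inter> \<Phi> = S)"
    using test_conjunction[OF fin dep] by simp
  then obtain ch where ch: "\<forall>S\<in>Pow \<Phi>. depth (ch S) \<le> n \<and> (\<forall>z\<in>Omega. ch S \<in> z \<longleftrightarrow> z \<inter> \<Phi> = S)"
    by (rule bchoice[THEN exE])
  let ?\<Psi> = "range Atom \<union> (\<Union>j. (\<lambda>S. K j (Neg (ch S))) ` Pow \<Phi>)"
  have fwd: "K j h \<in> z'"
    if z: "z \<in> Omega" "z' \<in> Omega" "z \<inter> ?\<Psi> = z' \<inter> ?\<Psi>" and h: "depth h < Suc n" "K j h \<in> z"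
    for z z' j h
  proof (rule ccontr)
    assume "K j h \<notin> z'"
    then obtain u' where u': "u' \<in> Omega" "part j u' = part j z'" "h \<notin> u'"
      by (rule Omega_K_exists[OF z(2)])
    let ?k = "ch (u' \<inter> \<Phi>)"
    have k: "?k \<in> u \<longleftrightarrow> u \<inter> \<Phi> = u' \<inter> \<Phi>" if "u \<in> Omega" for u using ch that by simp
    have "K j (Neg ?k) \<notin> u'" using Omega_K[OF u'(1), of j "Neg ?k"] k u'(1) by auto
    then have "K j (Neg ?k) \<notin> z'" using part_eqD[OF u'(2)] by simp
    moreover have "K j (Neg ?k) \<in> ?\<Psi>" by blast
    ultimately have "K j (Neg ?k) \<notin> z" using z(3) by auto
    then obtain u where u: "u \<in> Omega" "part j u = part j z" "Neg ?k \<notin> u"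
      by (rule Omega_K_exists[OF z(1)])
    then have "agree n u u'" using agr u'(1) k[OF u(1)] by simp
    moreover have "h \<in> u" using Omega_K[OF u(1), of j h] part_eqD[OF u(2), of h] h(2) by simp
    ultimately show False using u'(3) h(1) agreeD[of n u u' h] by simp
  qed
  show ?case
  proof (intro exI[of _ ?\<Psi>] conjI ballI impI)
    show "finite ?\<Psi>" using fin by simp
    show "depth g \<le> Suc n" if "g \<in> ?\<Psi>" for g using that ch by auto
    fix z z' :: "('x, 'j) fm set"
    assume z: "z \<in> Omega" "z' \<in> Omega" "z \<inter> ?\<Psi> = z' \<inter> ?\<Psi>"
    show "agree (Suc n) z z'"
    proof (rule agreeI_modal[OF z(1,2)])
      show "Atom x \<in> z \<longleftrightarrow> Atom x \<in> z'" for x using z(3) by auto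
      show "K j h \<in> z \<longleftrightarrow> K j h \<in> z'" if "depth h < Suc n" for j h
        using fwd[OF z that] fwd[OF z(2,1) z(3)[symmetric] that] by (rule iffI)
    qed
  qed
qed

lemma characteristic_formula:
  fixes z :: "('x::finite, 'j::finite) fm set"
  assumes "z \<in> Omega"
  obtains ch where "depth ch \<le> n" "ch \<in> z" "\<And>z'. z' \<in> Omega \<Longrightarrow> ch \<in> z' \<Longrightarrow> agree n z z'"
proof -
  obtain \<Phi> :: "('x, 'j) fm set" where fin: "finite \<Phi>" and dep: "\<forall>g\<in>\<Phi>. depth g \<le> n"
    and agr: "\<forall>z\<in>Omega. \<forall>z'\<in>Omega. z \<inter> \<Phi> = z' \<inter> \<Phi> \<longrightarrow> agree n z z'"
    using finite_test_set[where 'x = 'x and 'j = 'j, of n] by (elim exE conjE)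
  obtain g where g: "depth g \<le> n" "\<forall>u\<in>Omega. g \<in> u \<longleftrightarrow> u \<inter> \<Phi> = z \<inter> \<Phi>"
    using test_conjunction[OF fin dep, of "z \<inter> \<Phi>"] by auto
  show thesis
  proof
    show "depth g \<le> n" by (rule g(1))
    show "g \<in> z" using g(2) assms by simp
    show "agree n z u" if "u \<in> Omega" "g \<in> u" for u
      using agr assms that g(2) by simp
  qed
qed

text \<open>The type of \<open>u\<close> to depth \<open>n\<close> is one formula, so its being
  possible for \<open>j\<close> is a fact of depth at most \<open>n + 1\<close>, which
  \<open>v\<close> shares. One depth is lost per step.\<close>

lemma lifting:
  fixes z v u :: "('x::finite, 'j::finite) fm set"
  assumes z: "z \<in> Omega" and v: "v \<in> Omega" and zv: "agree (Suc n) z v"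
    and u: "u \<in> Omega" "part j u = part j z"
  obtains u' where "u' \<in> Omega" "part j u' = part j v" "agree n u u'"
proof -
  obtain ch where ch: "depth ch \<le> n" "ch \<in> u" "\<And>z'. z' \<in> Omega \<Longrightarrow> ch \<in> z' \<Longrightarrow> agree n u z'"
    using characteristic_formula[OF u(1), of n] by metis
  have "K j (Neg ch) \<notin> z"
    using ch(2) Omega_K[OF u(1), of j "Neg ch"] part_eqD[OF u(2), of "Neg ch"] u(1) by auto
  then have "K j (Neg ch) \<notin> v" using agreeD[OF zv, of "K j (Neg ch)"] ch(1) by simp
  then obtain u' where "u' \<in> Omega" "part j u' = part j v" "Neg ch \<notin> u'"
    by (rule Omega_K_exists[OF v])
  then show thesis using that ch(3) by simp
qed

section \<open>Possibility sets and cells\<close>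

definition poss :: "'j \<Rightarrow> ('x, 'j) fm set \<Rightarrow> ('x, 'j) fm set set" where
  "poss j z = {z' \<in> Omega. part j z' = part j z}"

text \<open>Reflexive on \<open>Omega\<close>, so \<open>adj ^^ n\<close> relates a state to the
  whole ball of radius \<open>n\<close>, not only to its sphere.\<close>

definition adj :: "(('x, 'j) fm set \<times> ('x, 'j) fm set) set" where
  "adj = {(z, z'). z \<in> Omega \<and> (\<exists>j. z' \<in> poss j z)}"

definition cell_of :: "('x, 'j) fm set \<Rightarrow> ('x, 'j) fm set set" where
  "cell_of z = adj\<^sup>* `` {z}"

lemma Q_eq: "Q j = poss j ` Omega"
proof -
  have "{(z, z'). z \<in> Omega \<and> z' \<in> Omega \<and> {g. K j g \<in> z} = {g. K j g \<in> z'}} `` {z} = poss j z"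
    if "z \<in> Omega" for z
    using that by (auto simp: poss_def part_def)
  then show ?thesis unfolding Q_def quotient_def UNION_singleton_eq_range by (rule image_cong[OF refl])
qed

lemma poss_self [simp]: "z \<in> Omega \<Longrightarrow> z \<in> poss j z"
  by (simp add: poss_def)

lemma poss_Omega: "z' \<in> poss j z \<Longrightarrow> z' \<in> Omega"
  by (simp add: poss_def)

lemma adjI: "z \<in> Omega \<Longrightarrow> z' \<in> poss j z \<Longrightarrow> (z, z') \<in> adj"
  by (auto simp: adj_def)

lemma adj_Omega: "(z, z') \<in> adj \<Longrightarrow> z \<in> Omega \<and> z' \<in> Omega"
  by (auto simp: adj_def poss_def)

lemma adj_refl: "z \<in> Omega \<Longrightarrow> (z, z) \<in> adj"
  by (auto simp: adj_def)

lemma sym_adj: "sym adj"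
  by (rule symI) (auto simp: adj_def poss_def)

lemma saturated_iff: "saturated C \<longleftrightarrow> C \<subseteq> Omega \<and> (\<forall>z z'. (z, z') \<in> adj \<longrightarrow> z \<in> C \<longrightarrow> z' \<in> C)"
proof
  assume C: "saturated C"
  have "z' \<in> C" if zz: "(z, z') \<in> adj" and z: "z \<in> C" for z z'
  proof -
    obtain j where "z \<in> Omega" "z' \<in> poss j z" using zz by (auto simp: adj_def)
    moreover have "poss j z \<in> Q j" "z \<in> poss j z"
      using \<open>z \<in> Omega\<close> by (auto simp: Q_eq)
    ultimately show ?thesis using C z unfolding saturated_def by blast
  qed
  then show "C \<subseteq> Omega \<and> (\<forall>z z'. (z, z') \<in> adj \<longrightarrow> z \<in> C \<longrightarrow> z' \<in> C)"
    using C by (auto simp: saturated_def)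
next
  assume C: "C \<subseteq> Omega \<and> (\<forall>z z'. (z, z') \<in> adj \<longrightarrow> z \<in> C \<longrightarrow> z' \<in> C)"
  have "P \<subseteq> C" if P: "P \<in> Q j" "P \<inter> C \<noteq> {}" for P j
  proof
    fix z' assume z': "z' \<in> P"
    obtain z where z: "z \<in> P" "z \<in> C" using P by blast
    have "z' \<in> poss j z" using P(1) z(1) z' by (auto simp: Q_eq poss_def)
    then have "(z, z') \<in> adj" using C z by (auto intro: adjI)
    then show "z' \<in> C" using C z by blast
  qed
  then show "saturated C" using C unfolding saturated_def by blast
qed

lemma saturated_cell_of:
  assumes "z \<in> Omega"
  shows "saturated (cell_of z)"
proof -
  have "z' \<in> Omega" if "(z, z') \<in> adj\<^sup>*" for z'
    using that by (induction rule: rtrancl_induct) (auto simp: assms dest: adj_Omega)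
  then show ?thesis
    unfolding saturated_iff cell_of_def by (auto intro: rtrancl_into_rtrancl)
qed

lemma cell_of_Omega: "z \<in> Omega \<Longrightarrow> s \<in> cell_of z \<Longrightarrow> s \<in> Omega"
  using saturated_cell_of saturated_iff by blast

lemma cell_of_self [simp]: "z \<in> cell_of z"
  by (simp add: cell_of_def)

lemma cell_of_step: "s \<in> cell_of z \<Longrightarrow> (s, t) \<in> adj \<Longrightarrow> t \<in> cell_of z"
  by (auto simp: cell_of_def intro: rtrancl_into_rtrancl)

lemma cell_of_eq:
  assumes "s \<in> cell_of z"
  shows "cell_of s = cell_of z"
proof -
  have 1: "(z, s) \<in> adj\<^sup>*" using assms by (simp add: cell_of_def)
  then have 2: "(s, z) \<in> adj\<^sup>*" using sym_adj by (meson sym_rtrancl symD)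
  show ?thesis
    unfolding cell_of_def using rtrancl_trans[OF 1] rtrancl_trans[OF 2] by auto
qed

lemma cell_of_subset: "saturated C \<Longrightarrow> z \<in> C \<Longrightarrow> cell_of z \<subseteq> C"
proof
  fix s assume C: "saturated C" "z \<in> C" and "s \<in> cell_of z"
  then have "(z, s) \<in> adj\<^sup>*" by (simp add: cell_of_def)
  then show "s \<in> C"
    by (induction rule: rtrancl_induct) (use C in \<open>auto simp: saturated_iff\<close>)
qed

lemma cell_cell_of:
  assumes "z \<in> Omega"
  shows "cell (cell_of z)"
  unfolding cell_def
proof (intro conjI allI impI; (elim conjE)?)
  show "saturated (cell_of z)" by (rule saturated_cell_of[OF assms])
  show "cell_of z \<noteq> {}" using cell_of_self by blast
  fix D assume D: "saturated D" "D \<noteq> {}" "D \<subseteq> cell_of z"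
  then obtain s where s: "s \<in> D" by blast
  then have "cell_of s = cell_of z" using D(3) by (intro cell_of_eq) blast
  then show "D = cell_of z" using cell_of_subset[OF D(1) s] D(3) by blast
qed

lemma cell_eq_cell_of:
  assumes "cell C" "z \<in> C"
  shows "C = cell_of z"
proof -
  have C: "saturated C" "\<And>D. saturated D \<Longrightarrow> D \<noteq> {} \<Longrightarrow> D \<subseteq> C \<Longrightarrow> D = C"
    using assms(1) unfolding cell_def by blast+
  moreover have "z \<in> Omega" using C(1) assms(2) by (auto simp: saturated_iff)
  moreover have "cell_of z \<noteq> {}" using cell_of_self by blast
  ultimately show ?thesis using saturated_cell_of cell_of_subset[OF C(1) assms(2)] by metis
qed

lemma finite_fanoutI:
  assumes "\<And>s j. s \<in> C \<Longrightarrow> finite (poss j s)"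
  shows "finite_fanout C"
  unfolding finite_fanout_def possibility_set_def
proof (intro allI impI, elim conjE exE)
  fix P j assume "P \<subseteq> C" "P \<in> Q j"
  then obtain z where "z \<in> Omega" "P = poss j z" by (auto simp: Q_eq)
  then have "z \<in> C" using \<open>P \<subseteq> C\<close> by auto
  then show "finite P" using assms \<open>P = poss j z\<close> by simp
qed

lemma finite_ball:
  assumes z: "z \<in> Omega" and fin: "\<And>s j. s \<in> cell_of z \<Longrightarrow> finite (poss (j::'j::finite) s)"
  shows "finite ((adj ^^ n) `` {z}) \<and> (adj ^^ n) `` {z} \<subseteq> cell_of z"
proof (induction n)
  case 0
  then show ?case by simp
next
  case (Suc n)
  have eq: "(adj ^^ Suc n) `` {z} = (\<Union>s\<in>(adj ^^ n) `` {z}. \<Union>j. poss j s)"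
    using Suc cell_of_Omega[OF z] by (auto simp: relcomp_unfold adj_def)
  have "(adj ^^ Suc n) `` {z} \<subseteq> cell_of z"
    using Suc by (auto intro: cell_of_step)
  then show ?case using Suc fin unfolding eq by auto
qed

lemma cell_of_ball: "cell_of z = (\<Union>n. (adj ^^ n) `` {z})"
  by (auto simp: cell_of_def rtrancl_power)

lemma countable_cell_of:
  assumes "z \<in> Omega" "\<And>s j. s \<in> cell_of z \<Longrightarrow> finite (poss (j::'j::finite) s)"
  shows "countable (cell_of z)"
  unfolding cell_of_ball using finite_ball[OF assms] by (intro countable_UN) (auto intro: countable_finite)

lemma adj_pow_mono:
  assumes "(z, s) \<in> adj ^^ n" "z \<in> Omega" "n \<le> m"
  shows "(z, s) \<in> adj ^^ m"
  using assms(3)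
proof (induction rule: dec_induct)
  case base
  then show ?case by (rule assms(1))
next
  case (step k)
  have "s \<in> cell_of z" using step.IH by (auto simp: cell_of_ball)
  then show ?case using step.IH adj_refl cell_of_Omega[OF assms(2)] by auto
qed

section \<open>Common knowledge\<close>

lemma Conj_in:
  assumes "z \<in> Omega" "gs \<noteq> []"
  shows "Conj gs \<in> z \<longleftrightarrow> set gs \<subseteq> z"
  using assms(2) by (induction gs rule: Conj.induct) (auto simp: assms(1))

lemma set_agents: "set (agents :: 'j::finite list) = UNIV"
proof -
  have "\<exists>js :: 'j list. distinct js \<and> set js = UNIV"
    using finite_distinct_list[OF finite_class.finite_UNIV] by metis
  then show ?thesis unfolding agents_def by (rule someI2_ex) simp
qed

lemma E_in: "z \<in> Omega \<Longrightarrow> E g \<in> z \<longleftrightarrow> (\<forall>j. K j g \<in> z)"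
proof -
  assume z: "z \<in> Omega"
  have "agents \<noteq> ([] :: 'b list)" using set_agents[where 'j = 'b] by auto
  then show ?thesis unfolding E_def using z
    by (subst Conj_in) (auto simp: set_agents)
qed

lemma Ck_Omega: "z \<in> Ck f \<Longrightarrow> z \<in> Omega"
  by (simp add: Ck_def)

lemma Ck_in: "z \<in> Ck f \<Longrightarrow> f \<in> z"
  unfolding Ck_def by (metis (mono_tags, lifting) funpow_0 mem_Collect_eq)

text \<open>Iteration \<open>n + 1\<close> of \<open>E\<close> asserts \<open>K j\<close> of
  iteration \<open>n\<close>, and what is known holds throughout the possibility set.\<close>

lemma Ck_poss:
  assumes "z \<in> Ck f" "z' \<in> poss j z"
  shows "z' \<in> Ck f"
proof -
  have z: "z \<in> Omega" and E: "\<And>n. (E ^^ n) f \<in> z" using assms(1) by (auto simp: Ck_def)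
  have z': "z' \<in> Omega" "part j z' = part j z" using assms(2) by (auto simp: poss_def)
  have "(E ^^ n) f \<in> z'" for n
  proof -
    have "K j ((E ^^ n) f) \<in> z" using E[of "Suc n"] E_in[OF z] by simp
    then show ?thesis using part_eqD[OF z'(2)] Omega_K[OF z'(1), of j] by metis
  qed
  then show ?thesis using z' by (simp add: Ck_def)
qed

lemma Ck_cell_of: "z \<in> Ck f \<Longrightarrow> cell_of z \<subseteq> Ck f"
  by (rule cell_of_subset) (auto simp: saturated_iff adj_def intro: Ck_poss Ck_Omega)

lemma CkI:
  assumes z: "z \<in> Omega" and f: "\<And>s. s \<in> cell_of z \<Longrightarrow> f \<in> s"
  shows "z \<in> Ck f"
proof -
  have "\<forall>s\<in>cell_of z. (E ^^ n) f \<in> s" for n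
  proof (induction n)
    case 0
    then show ?case using f by simp
  next
    case (Suc n)
    show ?case
    proof
      fix s assume s: "s \<in> cell_of z"
      have "s \<in> Omega" by (rule cell_of_Omega[OF z s])
      moreover have "K j ((E ^^ n) f) \<in> s" for j
        unfolding Omega_K_iff[OF \<open>s \<in> Omega\<close>]
        using Suc cell_of_step[OF s adjI[OF \<open>s \<in> Omega\<close>]] by (auto simp: poss_def)
      ultimately show "(E ^^ Suc n) f \<in> s" by (simp add: E_in)
    qed
  qed
  then show ?thesis using z cell_of_self by (auto simp: Ck_def)
qed

section \<open>Density in terms of formulas\<close>

lemma openin_Omega_top:
  assumes "openin Omega_top U" "u \<in> U"
  shows "\<exists>g. g \<in> u \<and> {z \<in> Omega. g \<in> z} \<subseteq> U"
proof -
  have "generate_topology_on {{z \<in> Omega. g \<in> z} | g. True} U"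
    using assms(1) by (simp add: Omega_top_def openin_topology_generated_by_iff)
  then have "u \<in> U \<Longrightarrow> u \<in> Omega \<and> (\<exists>g. g \<in> u \<and> {z \<in> Omega. g \<in> z} \<subseteq> U)"
  proof induction
    case (Int a b)
    then obtain g h where "u \<in> Omega" "g \<in> u" "h \<in> u"
      "{z \<in> Omega. g \<in> z} \<subseteq> a" "{z \<in> Omega. h \<in> z} \<subseteq> b" by auto
    then show ?case by (intro conjI exI[of _ "And g h"]) auto
  next
    case (UN A)
    then show ?case by blast
  qed auto
  then show ?thesis using assms(2) by blast
qed

lemma openin_basic: "openin Omega_top {z \<in> Omega. g \<in> z}"
  unfolding Omega_top_def by (rule topology_generated_by_Basis) blast

definition dense :: "('x, 'j::finite) fm \<Rightarrow> ('x, 'j) fm set set \<Rightarrow> bool" where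
  "dense f C \<longleftrightarrow> (\<forall>g. \<forall>u\<in>Ck f. g \<in> u \<longrightarrow> (\<exists>s\<in>C. g \<in> s))"

lemma dense_in_Ck_iff: "dense_in_Ck C f \<longleftrightarrow> C \<subseteq> Ck f \<and> dense f C"
proof (intro iffI conjI)
  assume d: "dense_in_Ck C f"
  show "C \<subseteq> Ck f" using d by (simp add: dense_in_Ck_def)
  show "dense f C"
    unfolding dense_def
  proof (intro allI ballI impI)
    fix g u assume u: "u \<in> Ck f" "g \<in> u"
    let ?T = "Ck f \<inter> {z \<in> Omega. g \<in> z}"
    have "u \<in> subtopology Omega_top (Ck f) closure_of C"
      using d u(1) by (simp add: dense_in_Ck_def)
    moreover have "openin (subtopology Omega_top (Ck f)) ?T"
      by (rule openin_subtopology_Int2[OF openin_basic])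
    moreover have "u \<in> ?T" using u Ck_Omega[OF u(1)] by simp
    ultimately have "\<exists>s. s \<in> C \<and> s \<in> ?T"
      using in_closure_of[THEN iffD1, THEN conjunct2, rule_format, of u "subtopology Omega_top (Ck f)" C ?T]
      by simp
    then show "\<exists>s\<in>C. g \<in> s" by auto
  qed
next
  assume C: "C \<subseteq> Ck f \<and> dense f C"
  have "u \<in> subtopology Omega_top (Ck f) closure_of C" if u: "u \<in> Ck f" for u
    unfolding in_closure_of
  proof (intro conjI allI impI, goal_cases)
    case 1
    have "u \<in> topspace Omega_top"
      using openin_subset[OF openin_basic, of f] Ck_Omega[OF u] Ck_in[OF u] by auto
    then show ?case using u by simp
  next
    case (2 T)
    then obtain U where U: "openin Omega_top U" "T = U \<inter> Ck f"
      by (auto simp: openin_subtopology)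
    then obtain g where g: "g \<in> u" "{z \<in> Omega. g \<in> z} \<subseteq> U"
      using openin_Omega_top[OF U(1), of u] 2 by auto
    obtain s where s: "s \<in> C" "g \<in> s"
      using C u g(1) unfolding dense_def by metis
    have "s \<in> Ck f" using C s(1) by auto
    then have "s \<in> T" using U(2) g(2) s(2) Ck_Omega[of s f] by auto
    then show ?case using s(1) by auto
  qed
  moreover have "subtopology Omega_top (Ck f) closure_of C \<subseteq> Ck f"
    using closure_of_subset_topspace[of "subtopology Omega_top (Ck f)" C] by auto
  ultimately show "dense_in_Ck C f" using C by (auto simp: dense_in_Ck_def)
qed

text \<open>By \<open>characteristic_formula\<close>, agreement with \<open>u\<close> to depth
  \<open>n\<close> is guaranteed on a basic open neighbourhood of \<open>u\<close>.\<close>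

lemma dense_agree:
  fixes f :: "('x::finite, 'j::finite) fm"
  assumes "dense f C" "C \<subseteq> Omega" "u \<in> Ck f"
  shows "\<exists>s\<in>C. agree n u s"
proof -
  obtain ch where ch: "ch \<in> u" "\<And>s. s \<in> Omega \<Longrightarrow> ch \<in> s \<Longrightarrow> agree n u s"
    using characteristic_formula[OF Ck_Omega[OF assms(3)], of n] by metis
  obtain s where "s \<in> C" "ch \<in> s" using assms(1,3) ch(1) unfolding dense_def by blast
  then show ?thesis using ch(2) assms(2) by blast
qed

text \<open>An isolated point of the set of common knowledge would lie in every dense set,
  but distinct cells are disjoint.\<close>

lemma no_isolated_point:
  fixes f :: "('x::finite, 'j::finite) fm"
  assumes C: "cell C" "cell C'" "C \<noteq> C'" "dense_in_Ck C f" "dense_in_Ck C' f"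
    and u: "u \<in> Ck f"
  shows "\<exists>v\<in>Ck f. v \<noteq> u \<and> agree n u v"
proof -
  have "u \<notin> C \<or> u \<notin> C'" using C cell_eq_cell_of by metis
  then obtain D where D: "dense_in_Ck D f" "u \<notin> D" using C by metis
  then have DC: "D \<subseteq> Ck f" "dense f D" by (simp_all add: dense_in_Ck_iff)
  then have "D \<subseteq> Omega" using Ck_Omega by auto
  then obtain s where "s \<in> D" "agree n u s" using dense_agree[OF DC(2) _ u] by metis
  then show ?thesis using D(2) DC(1) by (intro bexI[of _ s]) auto
qed

text \<open>Agreement classes of increasing depth form a neighbourhood base, so this says that
  \<open>Ck f\<close> has no isolated points.\<close>

definition perfect :: "('x, 'j::finite) fm \<Rightarrow> bool" where
  "perfect f \<longleftrightarrow> (\<forall>u\<in>Ck f. \<forall>n. \<exists>v\<in>Ck f. v \<noteq> u \<and> agree n u v)"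

text \<open>Finitely many states near \<open>u\<close> would be separated from \<open>u\<close> at
  some depth \<open>m\<close>. A point \<open>v\<close> other than \<open>u\<close> within that
  depth, approximated from \<open>D\<close>, yields one more.\<close>

lemma perfect_dense_infinite:
  fixes f :: "('x::finite, 'j::finite) fm"
  assumes f: "perfect f" and D: "dense f D" "D \<subseteq> Ck f" and u: "u \<in> Ck f"
  shows "infinite {s \<in> D. agree n u s}"
proof
  assume fin: "finite {s \<in> D. agree n u s}" (is "finite ?S")
  have "insert u ?S \<subseteq> Omega" using D(2) u Ck_Omega by auto
  then obtain m where m: "m \<ge> n" "\<forall>z\<in>insert u ?S. \<forall>z'\<in>insert u ?S. agree m z z' \<longrightarrow> z = z'"
    using separating_level[of "insert u ?S" n] fin by auto
  obtain v where v: "v \<in> Ck f" "v \<noteq> u" "agree m u v"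
    using f u unfolding perfect_def by metis
  then obtain k where k: "\<not> agree k u v"
    using not_agree_ex[OF Ck_Omega[OF u] Ck_Omega[OF v(1)]] by auto
  have DO: "D \<subseteq> Omega" using D(2) Ck_Omega by auto
  \<comment> \<open>Depth \<open>m\<close> keeps \<open>s\<close> near \<open>u\<close>, depth
    \<open>k\<close> keeps it different from \<open>u\<close>.\<close>
  obtain s where s: "s \<in> D" "agree (max m k) v s" using dense_agree[OF D(1) DO v(1)] by metis
  have "agree m u s" using v(3) s(2) agree_trans agree_mono max.cobounded1 by metis
  then have "s \<in> ?S" using s(1) m(1) agree_mono[of m u s n] by simp
  then have "s = u" using m(2) \<open>agree m u s\<close> by auto
  then have "agree k u v" using s(2) agree_mono agree_sym max.cobounded2 by metis
  then show False using k by contradiction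
qed

section \<open>Kripke models\<close>

text \<open>The partition of agent \<open>j\<close> is given by the fibres of \<open>key j\<close>. Every point \<open>s\<close> is
  labelled by a state \<open>lab s\<close> that its theory is to match up to depth \<open>lev s\<close>.\<close>

locale labelled_model =
  fixes W :: "'s set" and key :: "'j::finite \<Rightarrow> 's \<Rightarrow> 'k"
    and lab :: "'s \<Rightarrow> ('x::finite, 'j) fm set" and lev :: "'s \<Rightarrow> nat" and f :: "('x, 'j) fm"
  assumes lab_Ck: "s \<in> W \<Longrightarrow> lab s \<in> Ck f"
    and lev_depth: "s \<in> W \<Longrightarrow> depth f \<le> lev s"
    and lev_adj: "s \<in> W \<Longrightarrow> t \<in> W \<Longrightarrow> key j t = key j s \<Longrightarrow> lev s \<le> Suc (lev t)"
    and zig: "s \<in> W \<Longrightarrow> t \<in> W \<Longrightarrow> key j t = key j s \<Longrightarrow> depth g < lev s \<Longrightarrow>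
      K j g \<in> lab s \<Longrightarrow> g \<in> lab t"
    and zag: "s \<in> W \<Longrightarrow> depth g < lev s \<Longrightarrow> K j g \<notin> lab s \<Longrightarrow>
      \<exists>t\<in>W. key j t = key j s \<and> g \<notin> lab t"
    and finite_class: "s \<in> W \<Longrightarrow> finite {t \<in> W. key j t = key j s}"
begin

primrec sat :: "'s \<Rightarrow> ('x, 'j) fm \<Rightarrow> bool" where
  "sat s (Atom x) \<longleftrightarrow> Atom x \<in> lab s"
| "sat s (Neg g) \<longleftrightarrow> \<not> sat s g"
| "sat s (And g h) \<longleftrightarrow> sat s g \<and> sat s h"
| "sat s (K j g) \<longleftrightarrow> (\<forall>t\<in>W. key j t = key j s \<longrightarrow> sat t g)"

definition th :: "'s \<Rightarrow> ('x, 'j) fm set" where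
  "th s = {g. sat s g}"

lemma sat_psubst: "sat s (psubst \<sigma> p) \<longleftrightarrow> peval (\<lambda>n. sat s (\<sigma> n)) p"
  by (induction p) auto

lemma sat_S5: "S5 g \<Longrightarrow> s \<in> W \<Longrightarrow> sat s g"
  by (induction arbitrary: s rule: S5.induct) (auto simp: sat_psubst tautology_def)

lemma th_Omega:
  assumes "s \<in> W"
  shows "th s \<in> Omega"
proof -
  have "g \<in> th s" if "derives (th s) g" for g
    using that by (induction rule: derives.induct) (use assms sat_S5 in \<open>auto simp: th_def\<close>)
  moreover have "\<not> (g \<in> th s \<and> Neg g \<in> th s)" for g by (simp add: th_def)
  ultimately have "consistent (th s)" unfolding consistent_iff by metis
  moreover have "complete_fms (th s)" unfolding complete_fms_def th_def by simp
  ultimately show ?thesis unfolding Omega_def by simp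
qed

lemma th_poss:
  assumes "s \<in> W" "t \<in> W" "key j t = key j s"
  shows "th t \<in> poss j (th s)"
  using assms th_Omega by (simp add: poss_def part_def th_def)

text \<open>The class of \<open>s\<close> is finite, so a state of \<open>poss j (th s)\<close> that
  is the theory of none of its points would be told from all of them by one conjunction
  \<open>g\<close>; then \<open>K j (Neg g)\<close> holds at \<open>s\<close>, against
  \<open>g\<close> at that state.\<close>

lemma poss_th:
  assumes s: "s \<in> W"
  shows "poss j (th s) = th ` {t \<in> W. key j t = key j s}" (is "_ = th ` ?B")
proof
  show "th ` ?B \<subseteq> poss j (th s)" using s th_poss by auto
  show "poss j (th s) \<subseteq> th ` ?B"
  proof
    fix z assume "z \<in> poss j (th s)"
    then have z: "z \<in> Omega" "part j z = part j (th s)" by (simp_all add: poss_def)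
    show "z \<in> th ` ?B"
    proof (rule ccontr)
      assume "z \<notin> th ` ?B"
      then have "\<forall>t\<in>?B. \<exists>g. g \<in> z \<and> g \<notin> th t"
        using Omega_subset_eq[OF z(1) th_Omega] by (metis (no_types, lifting) imageI mem_Collect_eq subsetI)
      then obtain D where D: "\<forall>t\<in>?B. D t \<in> z \<and> D t \<notin> th t" by (rule bchoice[THEN exE])
      obtain g where g: "\<forall>z\<in>Omega. g \<in> z \<longleftrightarrow> D ` ?B \<subseteq> z"
        using finite_Conj_ex[of "D ` ?B"] finite_class[OF s] by auto
      have "D ` ?B \<subseteq> z" using D by auto
      then have "g \<in> z" using g z(1) by simp
      have "g \<notin> th t" if "t \<in> ?B" for t using g D that th_Omega[of t] by auto
      then have "K j (Neg g) \<in> th s" by (simp add: th_def)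
      then have "K j (Neg g) \<in> z" using part_eqD[OF z(2)] by simp
      then have "Neg g \<in> z" by (rule Omega_K[OF z(1)])
      then show False using \<open>g \<in> z\<close> z(1) by simp
    qed
  qed
qed

lemma finite_poss_th: "s \<in> W \<Longrightarrow> finite (poss j (th s))"
  by (simp add: poss_th finite_class)

lemma cell_of_th:
  assumes "s \<in> W"
  shows "cell_of (th s) \<subseteq> th ` W"
proof
  fix z assume "z \<in> cell_of (th s)"
  then have "(th s, z) \<in> adj\<^sup>*" by (simp add: cell_of_def)
  then show "z \<in> th ` W"
    by (induction rule: rtrancl_induct) (use assms poss_th in \<open>auto simp: adj_def\<close>)
qed

text \<open>By \<open>lev_adj\<close> the level drops by at most one along a step, exactly the depth
  that is gained on passing below \<open>K\<close>.\<close>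

lemma sat_lab: "s \<in> W \<Longrightarrow> depth g \<le> lev s \<Longrightarrow> sat s g \<longleftrightarrow> g \<in> lab s"
proof (induction g arbitrary: s)
  case (K j g)
  show ?case
  proof
    assume sat: "sat s (K j g)"
    show "K j g \<in> lab s"
    proof (rule ccontr)
      assume k: "K j g \<notin> lab s"
      obtain t where t: "t \<in> W" "key j t = key j s" "g \<notin> lab t"
        using zag[OF K.prems(1) _ k] K.prems(2) by auto
      then have "depth g \<le> lev t" using lev_adj[OF K.prems(1) t(1,2)] K.prems(2) by simp
      then show False using K.IH[OF t(1)] sat t by simp
    qed
  next
    assume k: "K j g \<in> lab s"
    have "sat t g" if t: "t \<in> W" "key j t = key j s" for t
    proof -
      have "depth g \<le> lev t" using lev_adj[OF K.prems(1) t] K.prems(2) by simp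
      moreover have "g \<in> lab t" using zig[OF K.prems(1) t _ k] K.prems(2) by simp
      ultimately show ?thesis using K.IH[OF t(1)] by simp
    qed
    then show "sat s (K j g)" by simp
  qed
qed (use Ck_Omega[OF lab_Ck] in auto)

lemma agree_th: "s \<in> W \<Longrightarrow> agree (lev s) (th s) (lab s)"
  by (simp add: agree_def th_def sat_lab)

text \<open>All points have level at least \<open>depth f\<close>, so \<open>f\<close> holds
  throughout the cell.\<close>

lemma th_Ck:
  assumes "s \<in> W"
  shows "th s \<in> Ck f"
proof (rule CkI[OF th_Omega[OF assms]])
  fix z assume "z \<in> cell_of (th s)"
  then obtain t where t: "t \<in> W" "z = th t" using cell_of_th[OF assms] by auto
  then show "f \<in> z"
    using agreeD[OF agree_th[OF t(1)] lev_depth[OF t(1)]] Ck_in[OF lab_Ck[OF t(1)]] by simp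
qed

lemma finite_poss_cell:
  assumes "s \<in> W" "z \<in> cell_of (th s)"
  shows "finite (poss j z)"
  using assms cell_of_th[OF assms(1)] finite_poss_th by auto

end

section \<open>A dense cell with finite fanout\<close>

text \<open>\<open>Block N v\<close> ranges over representatives of the types of depth \<open>N\<close> in the set of common
  knowledge, which form a finite model; \<open>Link N\<close> joins block \<open>N\<close> to block \<open>N + 1\<close>.\<close>

datatype 'a chain_point = Block nat 'a | Link nat

text \<open>Fixes the class of a state in the partition \<open>Fbar n j\<close>; for
  \<open>n = 0\<close> it is empty, in accordance with the single class of
  \<open>Fbar 0 j\<close>.\<close>

definition low_part :: "'j \<Rightarrow> nat \<Rightarrow> ('x, 'j) fm set \<Rightarrow> ('x, 'j) fm set" where
  "low_part j n z = {g. depth g < n \<and> K j g \<in> z}"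

lemma low_part_agree: "agree n z z' \<Longrightarrow> low_part j n z = low_part j n z'"
  by (auto simp: low_part_def agree_def)

lemma low_part_poss: "z' \<in> poss j z \<Longrightarrow> low_part j n z' = low_part j n z"
  by (auto simp: low_part_def poss_def part_def)

locale chain =
  fixes f :: "('x::finite, 'j::finite) fm" and c :: "('x, 'j) fm set" and i :: 'j
  assumes c: "c \<in> Ck f"
begin

definition rep :: "nat \<Rightarrow> ('x, 'j) fm set \<Rightarrow> ('x, 'j) fm set" where
  "rep n u = (SOME v. v \<in> Ck f \<and> agree n u v)"

fun lab :: "('x, 'j) fm set chain_point \<Rightarrow> ('x, 'j) fm set" where
  "lab (Block n v) = v"
| "lab (Link n) = c"

fun lev :: "('x, 'j) fm set chain_point \<Rightarrow> nat" where
  "lev (Block n v) = n"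
| "lev (Link n) = n"

text \<open>Agent \<open>i\<close> places a link in its lower block, everyone else in the upper one;
  with two agents this glues the blocks.\<close>

fun block :: "'j \<Rightarrow> ('x, 'j) fm set chain_point \<Rightarrow> nat" where
  "block j (Block n v) = n"
| "block j (Link n) = (if j = i then n else Suc n)"

definition key :: "'j \<Rightarrow> ('x, 'j) fm set chain_point \<Rightarrow> nat \<times> ('x, 'j) fm set" where
  "key j p = (block j p, low_part j (block j p) (lab p))"

definition W :: "('x, 'j) fm set chain_point set" where
  "W = {p. depth f \<le> lev p \<and> (\<forall>n v. p = Block n v \<longrightarrow> v \<in> rep n ` Ck f)}"

definition pt :: "nat \<Rightarrow> ('x, 'j) fm set \<Rightarrow> ('x, 'j) fm set chain_point" where
  "pt n u = Block n (rep n u)"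

lemma rep:
  assumes "u \<in> Ck f"
  shows "rep n u \<in> Ck f" "agree n u (rep n u)"
proof -
  have "rep n u \<in> Ck f \<and> agree n u (rep n u)"
    unfolding rep_def by (rule someI[of _ u]) (simp add: assms)
  then show "rep n u \<in> Ck f" "agree n u (rep n u)" by simp_all
qed

lemma rep_cong:
  assumes "agree n u v"
  shows "rep n u = rep n v"
proof -
  have "agree n u w = agree n v w" for w using assms agree_sym agree_trans by metis
  then show ?thesis by (simp add: rep_def)
qed

lemma finite_rep: "finite (rep n ` Ck f)"
proof -
  obtain \<Phi> :: "('x, 'j) fm set" where fin: "finite \<Phi>"
    and agr: "\<forall>z\<in>Omega. \<forall>z'\<in>Omega. z \<inter> \<Phi> = z' \<inter> \<Phi> \<longrightarrow> agree n z z'"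
    using finite_test_set[where 'x = 'x and 'j = 'j, of n] by (elim exE conjE)
  have rr: "rep n (rep n u) = rep n u" if "u \<in> Ck f" for u
    using rep_cong[OF rep(2)[OF that]] by simp
  have "inj_on (\<lambda>z. z \<inter> \<Phi>) (rep n ` Ck f)"
  proof (rule inj_onI)
    fix r r' assume r: "r \<in> rep n ` Ck f" "r' \<in> rep n ` Ck f" "r \<inter> \<Phi> = r' \<inter> \<Phi>"
    then have "r \<in> Omega" "r' \<in> Omega" using Ck_Omega[OF rep(1)] by auto
    then have "agree n r r'" using agr r(3) by simp
    then have "rep n r = rep n r'" by (rule rep_cong)
    moreover have "rep n r = r" "rep n r' = r'" using r(1,2) rr by auto
    ultimately show "r = r'" by simp
  qed
  moreover have "finite ((\<lambda>z. z \<inter> \<Phi>) ` rep n ` Ck f)"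
    by (rule finite_subset[of _ "Pow \<Phi>"]) (auto simp: fin)
  ultimately show ?thesis using finite_imageD by blast
qed

lemma lev_block: "lev p \<le> block j p" "block j p \<le> Suc (lev p)"
  by (cases p; simp)+

lemma lab_Ck: "p \<in> W \<Longrightarrow> lab p \<in> Ck f"
  by (cases p) (auto simp: W_def c rep(1))

lemma pt_W: "u \<in> Ck f \<Longrightarrow> depth f \<le> n \<Longrightarrow> pt n u \<in> W"
  by (simp add: W_def pt_def)

lemma key_pt:
  assumes "u \<in> Ck f"
  shows "key j (pt n u) = (n, low_part j n u)"
  using low_part_agree[OF rep(2)[OF assms]] by (simp add: key_def pt_def)

sublocale labelled_model W key lab lev f
proof
  fix s t :: "('x, 'j) fm set chain_point" and j and g :: "('x, 'j) fm"
  show "s \<in> W \<Longrightarrow> lab s \<in> Ck f" by (rule lab_Ck)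
  show "s \<in> W \<Longrightarrow> depth f \<le> lev s" by (simp add: W_def)
  show "lev s \<le> Suc (lev t)" if "key j t = key j s"
    using that lev_block(1)[of s j] lev_block(2)[of j t] by (simp add: key_def)
  show "g \<in> lab t" if "s \<in> W" "t \<in> W" "key j t = key j s" "depth g < lev s" "K j g \<in> lab s"
  proof -
    have "g \<in> low_part j (block j s) (lab s)"
      using that(4,5) lev_block(1)[of s j] by (simp add: low_part_def)
    then have "g \<in> low_part j (block j t) (lab t)" using that(3) unfolding key_def by (metis prod.inject)
    then have "K j g \<in> lab t" by (simp add: low_part_def)
    then show ?thesis using Omega_K Ck_Omega lab_Ck that(2) by metis
  qed
  show "\<exists>t\<in>W. key j t = key j s \<and> g \<notin> lab t"
    if asm: "s \<in> W" "depth g < lev s" "K j g \<notin> lab s"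
  proof -
    obtain u where "u \<in> Omega" "part j u = part j (lab s)" and g: "g \<notin> u"
      by (rule Omega_K_exists[OF Ck_Omega[OF lab_Ck[OF asm(1)]] asm(3)])
    then have u: "u \<in> poss j (lab s)" by (simp add: poss_def)
    then have uC: "u \<in> Ck f" using Ck_poss lab_Ck asm(1) by metis
    \<comment> \<open>The representative has the type of \<open>u\<close> to the depth of the block
      in which \<open>j\<close> places \<open>s\<close>; this keeps the key and refutes
      \<open>g\<close>.\<close>
    let ?t = "pt (block j s) u"
    have "?t \<in> W"
      by (rule pt_W[OF uC]) (use asm(1) lev_block(1)[of s j] in \<open>simp add: W_def\<close>)
    moreover have "key j ?t = key j s"
      unfolding key_pt[OF uC] low_part_poss[OF u] by (simp add: key_def)
    moreover have "g \<notin> lab ?t"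
      using agreeD[OF rep(2)[OF uC, of "block j s"], of g] g asm(2) lev_block(1)[of s j] by (simp add: pt_def)
    ultimately show ?thesis by (intro bexI[of _ ?t] conjI)
  qed
  \<comment> \<open>For agent \<open>i\<close> a link in the class has the index of the block, for
    the others the index before it.\<close>
  have "t \<in> Block (block j s) ` rep (block j s) ` Ck f \<union> Link ` {..block j s}"
    if "t \<in> W" "key j t = key j s" for t
    using that by (cases t) (auto simp: W_def key_def split: if_splits)
  then have "{t \<in> W. key j t = key j s}
      \<subseteq> Block (block j s) ` rep (block j s) ` Ck f \<union> Link ` {..block j s}" by auto
  then show "finite {t \<in> W. key j t = key j s}"
    by (rule finite_subset) (simp add: finite_rep)
qed

lemma cell_of_th_eq:
  assumes "s \<in> W" "t \<in> W" "key j t = key j s"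
  shows "cell_of (th t) = cell_of (th s)"
  using assms th_poss th_Omega by (intro cell_of_eq cell_of_step[OF cell_of_self] adjI)

text \<open>A path in the cell of \<open>c\<close> is followed inside block \<open>n\<close>, since
  members of one possibility set share their \<open>low_part\<close>.\<close>

lemma cell_of_pt:
  assumes n: "depth f \<le> n" and u: "u \<in> cell_of c"
  shows "cell_of (th (pt n u)) = cell_of (th (pt n c))"
proof -
  have "(c, u) \<in> adj\<^sup>*" using u by (simp add: cell_of_def)
  then have "u \<in> Ck f \<and> cell_of (th (pt n u)) = cell_of (th (pt n c))"
  proof (induction rule: rtrancl_induct)
    case base
    then show ?case by (simp add: c)
  next
    case (step u v)
    then obtain j where v: "v \<in> poss j u" by (auto simp: adj_def)
    then have "v \<in> Ck f" using step.IH Ck_poss by metis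
    moreover have "key j (pt n v) = key j (pt n u)"
      using key_pt step.IH \<open>v \<in> Ck f\<close> low_part_poss[OF v] by simp
    ultimately show ?case using step.IH cell_of_th_eq pt_W n by metis
  qed
  then show ?thesis by simp
qed

text \<open>\<open>Link n\<close> carries the label \<open>c\<close>: agent \<open>i\<close> joins
  it to \<open>pt n c\<close>, agent \<open>l\<close> to \<open>pt (Suc n) c\<close>.\<close>

lemma cell_of_pt_c:
  assumes "l \<noteq> i" "depth f \<le> n"
  shows "cell_of (th (pt n c)) = cell_of (th (pt (depth f) c))"
  using assms(2)
proof (induction rule: dec_induct)
  case base
  then show ?case by simp
next
  case (step n)
  have W: "pt n c \<in> W" "pt (Suc n) c \<in> W" "Link n \<in> W"
    by (rule pt_W[OF c], use step in simp)+ (use step in \<open>simp add: W_def\<close>)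
  have "key i (Link n) = key i (pt n c)" "key l (pt (Suc n) c) = key l (Link n)"
    unfolding key_pt[OF c] using assms(1) by (simp_all add: key_def)
  then show ?case using step.IH cell_of_th_eq W by metis
qed

text \<open>The blocks used lie in one cell, and a formula met in the cell of \<open>c\<close> is
  met in every block that is deep enough.\<close>

lemma dense_finite_cell:
  assumes "l \<noteq> i" "dense f (cell_of c)"
  shows "\<exists>z\<in>Ck f. dense f (cell_of z) \<and> (\<forall>s\<in>cell_of z. \<forall>j. finite (poss j s))"
proof (intro bexI[of _ "th (pt (depth f) c)"] conjI ballI allI)
  let ?z = "th (pt (depth f) c)"
  have W: "pt (depth f) c \<in> W" by (rule pt_W[OF c order_refl])
  show "?z \<in> Ck f" by (rule th_Ck[OF W])
  show "finite (poss j s)" if "s \<in> cell_of ?z" for s j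
    using finite_poss_cell[OF W that] .
  show "dense f (cell_of ?z)"
    unfolding dense_def
  proof (intro allI ballI impI)
    fix g u assume "u \<in> Ck f" "g \<in> u"
    then obtain s where s: "s \<in> cell_of c" "g \<in> s" using assms(2) unfolding dense_def by metis
    then have sC: "s \<in> Ck f" using Ck_cell_of[OF c] by auto
    define n where "n = max (depth f) (depth g)"
    have n: "depth f \<le> n" "depth g \<le> n" by (simp_all add: n_def)
    have "g \<in> rep n s" using agreeD[OF rep(2)[OF sC] n(2)] s(2) by simp
    then have "g \<in> th (pt n s)"
      using agreeD[OF agree_th[OF pt_W[OF sC n(1)]], of g] n(2) by (simp add: pt_def)
    moreover have "th (pt n s) \<in> cell_of ?z"
      using cell_of_pt[OF n(1) s(1)] cell_of_pt_c[OF assms(1) n(1)] cell_of_self by metis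
    ultimately show "\<exists>s\<in>cell_of ?z. g \<in> s" by (intro bexI)
  qed
qed

end

section \<open>Perturbing a cell far away from a given point\<close>

text \<open>\<open>Join\<close> is a new member of the possibility set of \<open>p\<close> for agent \<open>i\<close>. For the other agents
  it belongs to the possibility set of the state \<open>y\<close> in a second copy of the cell.\<close>

datatype 'a join_point = Old 'a | New 'a | Join

locale join =
  fixes f :: "('x::finite, 'j::finite) fm" and p y :: "('x, 'j) fm set" and i :: 'j and n :: nat
  assumes p: "p \<in> Ck f" and y: "y \<in> cell_of p" and agree_py: "agree n p y"
    and fin: "s \<in> cell_of p \<Longrightarrow> finite (poss j s)" and depth_n: "depth f \<le> n"
begin

definition dist :: "('x, 'j) fm set \<Rightarrow> nat" where
  "dist s = (LEAST m. (p, s) \<in> adj ^^ m)"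

fun lab :: "('x, 'j) fm set join_point \<Rightarrow> ('x, 'j) fm set" where
  "lab (Old s) = s"
| "lab (New s) = s"
| "lab Join = p"

text \<open>A change at \<open>Join\<close> reaches an old state at distance \<open>m\<close> from
  \<open>p\<close> only through formulas of depth greater than \<open>n + m\<close>.\<close>

fun lev :: "('x, 'j) fm set join_point \<Rightarrow> nat" where
  "lev (Old s) = n + dist s"
| "lev (New s) = n"
| "lev Join = n"

fun key :: "'j \<Rightarrow> ('x, 'j) fm set join_point \<Rightarrow> bool \<times> ('x, 'j) fm set" where
  "key j (Old s) = (False, part j s)"
| "key j (New s) = (True, part j s)"
| "key j Join = (if j = i then (False, part i p) else (True, part j y))"

definition W :: "('x, 'j) fm set join_point set" where
  "W = Old ` cell_of p \<union> New ` cell_of p \<union> {Join}"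

lemma pO: "p \<in> Omega" and sO: "s \<in> cell_of p \<Longrightarrow> s \<in> Omega"
  using Ck_Omega[OF p] cell_of_Omega by auto

lemma W_simps [simp]: "Old s \<in> W \<longleftrightarrow> s \<in> cell_of p" "New s \<in> W \<longleftrightarrow> s \<in> cell_of p" "Join \<in> W"
  by (auto simp: W_def)

lemma lab_cell: "s \<in> W \<Longrightarrow> lab s \<in> cell_of p"
  by (cases s) auto

lemma poss_cell: "s \<in> cell_of p \<Longrightarrow> t \<in> poss j s \<Longrightarrow> t \<in> cell_of p"
  using cell_of_step adjI sO by metis

lemma dist_path: "s \<in> cell_of p \<Longrightarrow> (p, s) \<in> adj ^^ dist s"
  unfolding dist_def cell_of_ball by (auto intro: LeastI)

lemma dist_le: "(p, s) \<in> adj ^^ m \<Longrightarrow> dist s \<le> m"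
  unfolding dist_def by (rule Least_le)

lemma dist_step:
  assumes "s \<in> cell_of p" "t \<in> poss j s"
  shows "dist t \<le> Suc (dist s)"
  using relpow_Suc_I[OF dist_path[OF assms(1)] adjI[OF sO[OF assms(1)] assms(2)]] by (rule dist_le)

lemma part_poss: "s \<in> cell_of p \<Longrightarrow> t \<in> cell_of p \<Longrightarrow> part j t = part j s \<Longrightarrow> t \<in> poss j s"
  by (simp add: poss_def sO)

lemma K_part: "t \<in> cell_of p \<Longrightarrow> part j t = part j s \<Longrightarrow> K j g \<in> s \<Longrightarrow> g \<in> t"
  using Omega_K[OF sO] part_eqD by metis

lemma zag_poss:
  assumes "s \<in> cell_of p" "K j g \<notin> s"
  shows "\<exists>u\<in>cell_of p. part j u = part j s \<and> g \<notin> u"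
proof -
  obtain u where "u \<in> Omega" "part j u = part j s" "g \<notin> u"
    by (rule Omega_K_exists[OF sO[OF assms(1)] assms(2)])
  then show ?thesis using poss_cell[OF assms(1), of u j] by (auto simp: poss_def)
qed

sublocale labelled_model W key lab lev f
proof
  fix s t :: "('x, 'j) fm set join_point" and j and g :: "('x, 'j) fm"
  show "s \<in> W \<Longrightarrow> lab s \<in> Ck f" using lab_cell Ck_cell_of[OF p] by auto
  show "s \<in> W \<Longrightarrow> depth f \<le> lev s" using depth_n by (cases s) auto
  show "lev s \<le> Suc (lev t)" if asm: "s \<in> W" "t \<in> W" "key j t = key j s"
  proof (cases s)
    case (Old u)
    show ?thesis
    proof (cases t)
      case t: (Old v)
      have "u \<in> poss j v" by (rule part_poss) (use asm Old t in simp_all)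
      then show ?thesis using dist_step[of v u j] Old t asm by simp
    next
      case t: Join
      have j: "j = i" using asm(3) Old t by (simp split: if_splits)
      have "u \<in> poss i p" by (rule part_poss) (use asm Old t j in simp_all)
      then show ?thesis using dist_step[of p u i] dist_le[of p 0] Old t asm by simp
    qed (use asm Old in simp)
  qed (cases t; simp)+
  have py: "K j g \<in> p \<longleftrightarrow> K j g \<in> y" if "depth g < n" for g j
    using agreeD[OF agree_py] that by simp
  have gpy: "g \<in> p \<longleftrightarrow> g \<in> y" if "depth g < n" for g
    using agreeD[OF agree_py] that by simp
  show "g \<in> lab t" if asm: "s \<in> W" "t \<in> W" "key j t = key j s" "depth g < lev s" "K j g \<in> lab s"
  \<comment> \<open>A key holds the part of the label except at \<open>Join\<close> for agents other
    than \<open>i\<close>, where the key comes from \<open>y\<close> and the label is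
    \<open>p\<close>; there agreement to depth \<open>n\<close> suffices.\<close>
  proof (cases "snd (key j t) = part j (lab t) \<and> snd (key j s) = part j (lab s)")
    case True
    then have "part j (lab t) = part j (lab s)" using asm(3) by metis
    then show ?thesis using K_part[OF lab_cell[OF asm(2)]] asm(5) by simp
  next
    case False
    then consider "t = Join" "j \<noteq> i" | "s = Join" "j \<noteq> i"
      by (cases s; cases t; cases "j = i") auto
    then show ?thesis
    proof cases
      case 1
      then have s: "s = Join \<or> (\<exists>u\<in>cell_of p. s = New u \<and> part j u = part j y)"
        using asm(1,3) by (cases s) auto
      from s have "depth g < n \<and> K j g \<in> y"
      proof (elim disjE bexE conjE)
        assume "s = Join"
        then show ?thesis using asm(4,5) py by simp
      next
        fix u assume "s = New u" "part j u = part j y"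
        then show ?thesis using asm(4,5) part_eqD[of j u y g] by simp
      qed
      then have "depth g < n" "K j g \<in> y" by simp_all
      then have "g \<in> y" using K_part[OF y refl] by simp
      then show ?thesis using gpy \<open>depth g < n\<close> 1 by simp
    next
      case 2
      then have t: "t = Join \<or> (\<exists>u\<in>cell_of p. t = New u \<and> part j u = part j y)"
        using asm(2,3) by (cases t) auto
      have "depth g < n" "K j g \<in> p" using asm(4,5) 2 by simp_all
      then have "K j g \<in> y" "g \<in> p" using py K_part[of p j p g] by simp_all
      from t show ?thesis
      proof (elim disjE bexE conjE)
        assume "t = Join"
        then show ?thesis using \<open>g \<in> p\<close> by simp
      next
        fix u assume "u \<in> cell_of p" "t = New u" "part j u = part j y"
        then show ?thesis using K_part[of u j y g] \<open>K j g \<in> y\<close> by simp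
      qed
    qed
  qed
  show "\<exists>t\<in>W. key j t = key j s \<and> g \<notin> lab t"
    if asm: "s \<in> W" "depth g < lev s" "K j g \<notin> lab s"
  proof (cases s)
    case (Old v)
    then obtain u where "u \<in> cell_of p" "part j u = part j v" "g \<notin> u"
      using zag_poss[of v j g] asm by auto
    then show ?thesis using Old by (intro bexI[of _ "Old u"]) auto
  next
    case (New v)
    then obtain u where "u \<in> cell_of p" "part j u = part j v" "g \<notin> u"
      using zag_poss[of v j g] asm by auto
    then show ?thesis using New by (intro bexI[of _ "New u"]) auto
  next
    case Join
    show ?thesis
    proof (cases "j = i")
      case True
      then obtain u where "u \<in> cell_of p" "part j u = part j p" "g \<notin> u"
        using zag_poss[of p j g] asm Join by auto
      then show ?thesis using Join True by (intro bexI[of _ "Old u"]) auto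
    next
      case False
      have "K j g \<notin> y" using asm Join py by simp
      then obtain u where "u \<in> cell_of p" "part j u = part j y" "g \<notin> u"
        using zag_poss[OF y, of j g] by auto
      then show ?thesis using Join False by (intro bexI[of _ "New u"]) auto
    qed
  qed
  have fin': "finite {u \<in> cell_of p. part j u = A}" for A
  proof (cases "\<exists>v\<in>cell_of p. part j v = A")
    case True
    then obtain v where v: "v \<in> cell_of p" "part j v = A" by auto
    have "{u \<in> cell_of p. part j u = A} \<subseteq> poss j v" using v part_poss by auto
    then show ?thesis using fin[OF v(1)] finite_subset by auto
  next
    case False
    then have "{u \<in> cell_of p. part j u = A} = {}" by auto
    then show ?thesis by (simp only: finite.emptyI)
  qed
  let ?A = "{u \<in> cell_of p. part j u = snd (key j s)}"
  have "t \<in> Old ` ?A \<union> New ` ?A \<union> {Join}" if "t \<in> W" "key j t = key j s" for t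
    using that by (cases t) (auto simp flip: that(2))
  then have "{t \<in> W. key j t = key j s} \<subseteq> Old ` ?A \<union> New ` ?A \<union> {Join}" by auto
  then show "finite {t \<in> W. key j t = key j s}"
    by (rule finite_subset) (simp add: fin')
qed

lemma cell_of_th_Old:
  assumes "s \<in> cell_of p" "t \<in> cell_of s"
  shows "th (Old t) \<in> cell_of (th (Old s))"
proof -
  have "(s, t) \<in> adj\<^sup>*" using assms(2) by (simp add: cell_of_def)
  then have "t \<in> cell_of p \<and> th (Old t) \<in> cell_of (th (Old s))"
  proof (induction rule: rtrancl_induct)
    case base
    then show ?case using assms(1) by simp
  next
    case (step u v)
    then obtain j where v: "v \<in> poss j u" by (auto simp: adj_def)
    then have "v \<in> cell_of p" using step.IH poss_cell by metis
    moreover have "th (Old v) \<in> poss j (th (Old u))"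
      by (rule th_poss) (use step.IH v \<open>v \<in> cell_of p\<close> in \<open>auto simp: poss_def\<close>)
    then have "th (Old v) \<in> cell_of (th (Old s))"
      using step.IH cell_of_step adjI th_Omega[of "Old u"] by (metis W_simps(1))
    ultimately show ?case by simp
  qed
  then show ?thesis by simp
qed

text \<open>Among the classes of old states, \<open>Join\<close> enters only that of
  \<open>p\<close> for agent \<open>i\<close>. Elsewhere the possibility set is an image of the old
  one, so it cannot grow.\<close>

lemma poss_th_Old:
  assumes s: "s \<in> cell_of p" and p_far: "p \<notin> poss j s"
  shows "poss j (th (Old s)) = (th \<circ> Old) ` poss j s"
proof -
  have "t \<in> Old ` poss j s" if t: "t \<in> W" "key j t = key j (Old s)" for t
  proof (cases t)
    case (Old u)
    then show ?thesis using t part_poss[OF s, of u j] by simp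
  next
    case Join
    then have "part j p = part j s" using t(2) by (simp split: if_splits)
    then show ?thesis using p_far part_poss[OF s cell_of_self] by simp
  qed (use t in simp)
  moreover have "Old u \<in> W \<and> key j (Old u) = key j (Old s)" if "u \<in> poss j s" for u
    using that poss_cell[OF s that] by (simp add: poss_def)
  ultimately have "{t \<in> W. key j t = key j (Old s)} = Old ` poss j s" by auto
  then show ?thesis using poss_th[of "Old s" j] s by (simp add: image_comp)
qed

text \<open>The radius is \<open>Suc k\<close> because the possibility sets of states within
  distance \<open>k\<close> reach one step further.\<close>

lemma ball_th_Old:
  assumes z: "z \<in> cell_of p" and far: "(z, p) \<notin> adj ^^ Suc k" and m: "m \<le> k"
    and v: "(th (Old z), v) \<in> adj ^^ m"
  shows "\<exists>s. (z, s) \<in> adj ^^ m \<and> s \<in> cell_of p \<and> v = th (Old s)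
    \<and> (\<forall>j. poss j v = (th \<circ> Old) ` poss j s)"
  using m v
proof (induction m arbitrary: v)
  have far': "p \<notin> poss j s" if s: "(z, s) \<in> adj ^^ m" "s \<in> cell_of p" "m \<le> k" for s m j
  proof
    assume "p \<in> poss j s"
    then have "(z, p) \<in> adj ^^ Suc m" using relpow_Suc_I[OF s(1)] adjI[OF sO[OF s(2)]] by simp
    then show False using far adj_pow_mono[OF _ sO[OF z], of p "Suc m" "Suc k"] s(3) by simp
  qed
  {
    case 0
    then show ?case using z far'[of z 0] poss_th_Old by (intro exI[of _ z]) auto
  next
    case (Suc m)
    then obtain w where w: "(th (Old z), w) \<in> adj ^^ m" "(w, v) \<in> adj" by auto
    then obtain s where s: "(z, s) \<in> adj ^^ m" "s \<in> cell_of p" "w = th (Old s)"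
      "\<forall>j. poss j w = (th \<circ> Old) ` poss j s" using Suc.IH[OF _ w(1)] Suc.prems(1) Suc_leD by metis
    obtain j where "v \<in> poss j w" using w(2) by (auto simp: adj_def)
    then obtain t where t: "t \<in> poss j s" "v = th (Old t)" using s(4) by auto
    have "t \<in> cell_of p" using poss_cell s(2) t(1) by metis
    moreover have "(z, t) \<in> adj ^^ Suc m"
      using relpow_Suc_I[OF s(1) adjI[OF sO[OF s(2)] t(1)]] .
    moreover have "poss j v = (th \<circ> Old) ` poss j t" for j
      unfolding t(2) using poss_th_Old far' calculation Suc.prems(1) by metis
    ultimately show ?case using t(2) by (intro exI[of _ t]) simp
  }
qed

text \<open>If the theory of \<open>z\<close> did not change, then along a path to \<open>p\<close> no theory would change, and
  the theory of \<open>Join\<close> would be \<open>p\<close>, the only state in its possibility set with the same type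
  of depth \<open>n\<close>. But what agent \<open>l\<close> knows at \<open>Join\<close> is what \<open>l\<close> knows at \<open>y\<close>.\<close>

lemma th_Old_neq:
  assumes z: "z \<in> cell_of p" "(z, p) \<in> adj ^^ D"
    and sep: "\<And>s t. (z, s) \<in> adj ^^ Suc D \<Longrightarrow> (z, t) \<in> adj ^^ Suc D \<Longrightarrow> agree n s t \<Longrightarrow> s = t"
    and l: "l \<noteq> i" "depth h \<le> n" "(K l h \<in> p) \<noteq> (K l h \<in> y)"
  shows "th (Old z) \<noteq> z"
proof
  assume eq: "th (Old z) = z"
  have ball: "(z, v) \<in> adj ^^ Suc D" if "(z, v) \<in> adj ^^ m" "m \<le> Suc D" for v m
    using adj_pow_mono[OF that(1) sO[OF z(1)] that(2)] .
  \<comment> \<open>Once the theory of a point is its label, the theory of a neighbour lies in the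
    ball of radius \<open>Suc D\<close>, where agreement to depth \<open>n\<close> with its label
    forces equality.\<close>
  have th: "s \<in> cell_of p \<and> th (Old s) = s" if "(z, s) \<in> adj ^^ m" "m \<le> D" for s m
    using that
  proof (induction m arbitrary: s)
    case 0
    then show ?case using z(1) eq by simp
  next
    case (Suc m)
    then obtain u where u: "(z, u) \<in> adj ^^ m" "(u, s) \<in> adj" by auto
    then have uC: "u \<in> cell_of p" "th (Old u) = u" using Suc by auto
    obtain j where s: "s \<in> poss j u" using u(2) by (auto simp: adj_def)
    have sC: "s \<in> cell_of p" by (rule poss_cell[OF uC(1) s])
    have "th (Old s) \<in> poss j (th (Old u))"
      by (rule th_poss) (use uC(1) sC s in \<open>auto simp: poss_def\<close>)
    then have "(z, th (Old s)) \<in> adj ^^ Suc m"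
      using relpow_Suc_I[OF u(1) adjI[OF sO[OF uC(1)]]] uC(2) by simp
    moreover have "agree n (th (Old s)) s" using agree_mono[OF agree_th[of "Old s"], of n] sC by simp
    ultimately show ?case using sep ball Suc.prems sC by (meson Suc_leD le_SucI)
  qed
  have "th Join \<in> poss i (th (Old p))" by (rule th_poss) simp_all
  then have "th Join \<in> poss i p" using th[OF z(2)] by simp
  \<comment> \<open>\<open>Join\<close> lies one step beyond \<open>p\<close>; hence the radius
    \<open>Suc D\<close> in \<open>sep\<close>.\<close>
  then have "(z, th Join) \<in> adj ^^ Suc D" using relpow_Suc_I[OF z(2) adjI[OF pO]] by simp
  moreover have "agree n (th Join) p" using agree_th[of Join] by simp
  ultimately have J: "th Join = p" using sep ball[OF z(2)] by simp
  \<comment> \<open>\<open>K l h\<close> may exceed the level of \<open>Join\<close>, so it is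
    evaluated over the class; \<open>h\<close> itself is within all levels.\<close>
  have "sat Join (K l h) \<longleftrightarrow> (\<forall>t\<in>W. key l t = key l Join \<longrightarrow> h \<in> lab t)"
  proof -
    have "sat t h \<longleftrightarrow> h \<in> lab t" if "t \<in> W" for t
      by (rule sat_lab[OF that]) (use l(2) in \<open>cases t; simp\<close>)
    then show ?thesis by simp
  qed
  also have "\<dots> \<longleftrightarrow> (\<forall>u\<in>poss l y. h \<in> u)"
  proof
    assume *: "\<forall>t\<in>W. key l t = key l Join \<longrightarrow> h \<in> lab t"
    show "\<forall>u\<in>poss l y. h \<in> u"
    proof
      fix u assume u: "u \<in> poss l y"
      then show "h \<in> u"
        using *[rule_format, of "New u"] poss_cell[OF y u] l(1) by (simp add: poss_def)
    qed
  next
    assume *: "\<forall>u\<in>poss l y. h \<in> u"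
    show "\<forall>t\<in>W. key l t = key l Join \<longrightarrow> h \<in> lab t"
    proof (intro ballI impI)
      fix t assume t: "t \<in> W" "key l t = key l Join"
      show "h \<in> lab t"
      proof (cases t)
        case (New u)
        then show ?thesis using * t l(1) part_poss[OF y] by simp
      next
        case Join
        then show ?thesis using * poss_self[OF sO[OF y]] agreeD[OF agree_py l(2)] by simp
      qed (use t l(1) in simp)
    qed
  qed
  also have "\<dots> \<longleftrightarrow> K l h \<in> y"
    unfolding Omega_K_iff[OF sO[OF y]] by (auto simp: poss_def)
  finally have "K l h \<in> th Join \<longleftrightarrow> K l h \<in> y" by (simp only: th_def mem_Collect_eq)
  then show False using J l(3) by simp
qed

end

section \<open>The perturbation step\<close>

definition admissible :: "('x, 'j::finite) fm \<Rightarrow> ('x, 'j) fm set \<Rightarrow> bool" where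
  "admissible f z \<longleftrightarrow> z \<in> Ck f \<and> dense f (cell_of z) \<and> (\<forall>s\<in>cell_of z. \<forall>j. finite (poss j s))"

definition fanout_le :: "nat \<Rightarrow> nat \<Rightarrow> ('x, 'j) fm set \<Rightarrow> bool" where
  "fanout_le k b z \<longleftrightarrow> (\<forall>s j. (z, s) \<in> adj ^^ k \<longrightarrow> finite (poss j s) \<and> card (poss j s) \<le> b)"

lemma admissible_ball:
  assumes "admissible f z"
  shows "finite ((adj ^^ n) `` {z})" "(adj ^^ n) `` {z} \<subseteq> cell_of z" "(adj ^^ n) `` {z} \<subseteq> Omega"
proof -
  have z: "z \<in> Omega" using assms Ck_Omega by (auto simp: admissible_def)
  have *: "finite ((adj ^^ n) `` {z}) \<and> (adj ^^ n) `` {z} \<subseteq> cell_of z"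
    by (rule finite_ball[OF z]) (use assms in \<open>auto simp: admissible_def\<close>)
  then show "finite ((adj ^^ n) `` {z})" "(adj ^^ n) `` {z} \<subseteq> cell_of z" by simp_all
  then show "(adj ^^ n) `` {z} \<subseteq> Omega" using cell_of_Omega[OF z] by auto
qed

lemma admissible_cell:
  assumes "admissible f z" "s \<in> cell_of z"
  shows "admissible f s"
  using assms Ck_cell_of[of z f] cell_of_eq[OF assms(2)] unfolding admissible_def by auto

lemma other_agent:
  assumes "CARD('j::finite) \<ge> 2"
  obtains i :: "'j::finite" where "l \<noteq> i"
proof -
  have "UNIV \<noteq> {l}" using assms by (metis One_nat_def card.empty card.insert empty_iff finite.emptyI
        not_less_eq_eq numeral_2_eq_2 order_refl)
  then show thesis using that by (metis UNIV_eq_I singleton_iff)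
qed

text \<open>Three choices matter: \<open>p\<close> outside the ball of radius \<open>Suc k\<close>;
  a depth \<open>n0\<close> separating a ball that reaches one step beyond \<open>p\<close>; and
  \<open>y\<close>, whose last depth \<open>n1\<close> of agreement with \<open>p\<close> is at
  least \<open>n0\<close>.\<close>

lemma perturb:
  fixes f :: "('x::finite, 'j::finite) fm"
  assumes f: "perfect f" and J: "CARD('j) \<ge> 2" and z: "admissible f z"
  shows "\<exists>z'. admissible f z' \<and> z' \<noteq> z \<and> agree n z z' \<and> (\<forall>m\<le>k. \<forall>b. fanout_le m b z \<longrightarrow> fanout_le m b z')"
proof -
  have zC: "z \<in> Ck f" and dns: "dense f (cell_of z)" using z by (simp_all add: admissible_def)
  have inf: "infinite {s \<in> cell_of z. agree m u s}" if "u \<in> Ck f" for m u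
    by (rule perfect_dense_infinite[OF f dns Ck_cell_of[OF zC] that])
  have "infinite (cell_of z)"
    using inf[OF zC, of 0] by (rule contrapos_nn) simp
  then have "\<not> cell_of z \<subseteq> (adj ^^ Suc k) `` {z}"
    using admissible_ball(1)[OF z, of "Suc k"] by (metis finite_subset)
  then obtain p where pz: "p \<in> cell_of z" "(z, p) \<notin> adj ^^ Suc k"
    unfolding subset_iff Image_singleton_iff by metis
  have pC: "p \<in> Ck f" using pz(1) Ck_cell_of[OF zC] by auto
  have cell: "cell_of p = cell_of z" by (rule cell_of_eq[OF pz(1)])
  obtain D where D: "(z, p) \<in> adj ^^ D" using pz(1) by (auto simp: cell_of_ball)
  let ?B = "(adj ^^ Suc D) `` {z}"
  obtain n0 where n0: "n0 \<ge> max n (depth f)"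
    and sep0: "\<forall>s\<in>?B. \<forall>t\<in>?B. agree n0 s t \<longrightarrow> s = t"
    using separating_level[OF admissible_ball(1)[OF z] admissible_ball(3)[OF z]] by metis
  obtain y where y: "y \<in> cell_of z" "agree n0 p y" "y \<noteq> p"
  proof -
    have "\<not> {s \<in> cell_of z. agree n0 p s} \<subseteq> {p}" using inf[OF pC, of n0] by (metis finite.emptyI finite.insertI finite_subset)
    then show thesis using that by auto
  qed
  have yO: "y \<in> Omega" and pO: "p \<in> Omega" using y(1) pz(1) cell_of_Omega[OF Ck_Omega[OF zC]] by auto
  \<comment> \<open>The first depth of disagreement: agreement just below it makes the join
    possible, disagreement at it makes the change visible.\<close>
  define M where "M = (LEAST m. \<not> agree m p y)"
  have M: "\<not> agree M p y" unfolding M_def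
    using not_agree_ex[OF pO yO] y(3) by (metis (mono_tags, lifting) LeastI)
  then have "n0 < M" using y(2) agree_mono by (metis not_le_imp_less)
  then obtain n1 where n1: "M = Suc n1" "n0 \<le> n1" by (cases M) auto
  have py: "agree n1 p y" using not_less_Least[of n1 "\<lambda>m. \<not> agree m p y"] n1(1) M_def by simp
  obtain l h where lh: "depth h \<le> n1" "(K l h \<in> p) \<noteq> (K l h \<in> y)"
  proof -
    have "Atom x \<in> p \<longleftrightarrow> Atom x \<in> y" for x using agreeD[OF py, of "Atom x"] by simp
    then have "\<exists>l h. depth h < Suc n1 \<and> (K l h \<in> p) \<noteq> (K l h \<in> y)"
      using agreeI_modal[OF pO yO, of "Suc n1"] M n1(1) by metis
    then show thesis using that less_Suc_eq_le by auto
  qed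
  \<comment> \<open>Agent \<open>i\<close> ties the new state to \<open>p\<close> and must differ
    from \<open>l\<close>, whose knowledge there is to be that of \<open>y\<close>.\<close>
  obtain i where i: "l \<noteq> i" by (rule other_agent[OF J])
  interpret join f p y i n1
  proof
    show "p \<in> Ck f" by (rule pC)
    show "y \<in> cell_of p" using y(1) cell by simp
    show "agree n1 p y" by (rule py)
    show "finite (poss j s)" if "s \<in> cell_of p" for s j using that z cell by (simp add: admissible_def)
    show "depth f \<le> n1" using n0 n1(2) by simp
  qed
  have zp: "z \<in> cell_of p" by (simp add: cell)
  let ?z = "th (Old z)"
  have zW: "Old z \<in> W" using zp by simp
  have "dense f (cell_of ?z)"
    unfolding dense_def
  proof (intro allI ballI impI)
    fix g u assume u: "u \<in> Ck f" "g \<in> u"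
    have pg: "admissible f p" by (rule admissible_cell[OF z pz(1)])
    \<comment> \<open>The type of \<open>u\<close> to depth \<open>depth g\<close> occurs infinitely
      often in the cell, but only finitely often near \<open>p\<close>; a far occurrence keeps
      \<open>g\<close>.\<close>
    have "\<not> {s \<in> cell_of z. agree (depth g) u s} \<subseteq> (adj ^^ depth g) `` {p}"
      using inf[OF u(1), of "depth g"] admissible_ball(1)[OF pg, of "depth g"] by (metis finite_subset)
    then obtain s where s: "s \<in> cell_of z" "agree (depth g) u s" "(p, s) \<notin> adj ^^ depth g" by auto
    then have sp: "s \<in> cell_of p" by (simp add: cell)
    have "\<not> dist s \<le> depth g" using adj_pow_mono[OF dist_path[OF sp] pO] s(3) by metis
    moreover have "g \<in> s" using agreeD[OF s(2)] u(2) by simp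
    ultimately have "g \<in> th (Old s)" using agreeD[OF agree_th[of "Old s"], of g] sp by simp
    moreover have "th (Old s) \<in> cell_of ?z" by (rule cell_of_th_Old[OF zp s(1)])
    ultimately show "\<exists>s\<in>cell_of ?z. g \<in> s" by (intro bexI)
  qed
  then have "admissible f ?z"
    unfolding admissible_def using th_Ck[OF zW] finite_poss_cell[OF zW] by simp
  moreover have "?z \<noteq> z"
  proof (rule th_Old_neq[OF zp D _ i lh])
    fix s t assume st: "(z, s) \<in> adj ^^ Suc D" "(z, t) \<in> adj ^^ Suc D" "agree n1 s t"
    then have "agree n0 s t" using agree_mono n1(2) by metis
    then show "s = t" using sep0 st(1,2) by simp
  qed
  moreover have "agree n z ?z"
    using agree_mono[OF agree_sym[OF agree_th[OF zW]], of n] n0 n1(2) by simp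
  moreover have "fanout_le m b ?z" if m: "m \<le> k" and b: "fanout_le m b z" for m b
    unfolding fanout_le_def
  proof (intro allI impI)
    fix v j assume "(?z, v) \<in> adj ^^ m"
    then obtain s where "(z, s) \<in> adj ^^ m" "poss j v = (th \<circ> Old) ` poss j s"
      using ball_th_Old[OF zp pz(2) m] by metis
    then show "finite (poss j v) \<and> card (poss j v) \<le> b"
      using b card_image_le[of "poss j s" "th \<circ> Old"] unfolding fanout_le_def
      by (metis finite_imageI le_trans)
  qed
  ultimately show ?thesis by (intro exI[of _ ?z]) simp
qed

section \<open>Limits\<close>

text \<open>Iterates \<open>lifting\<close>, at the cost of one depth per step.\<close>

lemma path_lifting:
  fixes z v :: "('x::finite, 'j::finite) fm set"
  assumes "z \<in> Omega" "v \<in> Omega" "agree (n + m) z v" "(z, s) \<in> adj ^^ m"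
  shows "\<exists>t. (v, t) \<in> adj ^^ m \<and> agree n s t \<and> t \<in> Omega"
  using assms(3,4)
proof (induction m arbitrary: n s)
  case 0
  then show ?case using assms by simp
next
  case (Suc m)
  then obtain u where u: "(z, u) \<in> adj ^^ m" "(u, s) \<in> adj" by auto
  then obtain t where t: "(v, t) \<in> adj ^^ m" "agree (Suc n) u t" "t \<in> Omega"
    using Suc.IH[of "Suc n" u] Suc.prems(1) by auto
  obtain j where j: "u \<in> Omega" "s \<in> Omega" "part j s = part j u"
    using u(2) by (auto simp: adj_def poss_def)
  obtain w where "w \<in> Omega" "part j w = part j t" "agree n s w"
    by (rule lifting[OF j(1) t(3,2) j(2,3)])
  then show ?case using relpow_Suc_I[OF t(1) adjI[OF t(3), of w j]] by (auto simp: poss_def)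
qed

text \<open>Finitely many members of \<open>poss j s\<close> are distinct at some depth
  \<open>n\<close>. They lift to distinct members of \<open>poss j t\<close>, where \<open>t\<close>
  ends a lifted path from an approximation \<open>v\<close>, so there are at most \<open>b\<close>
  of them.\<close>

lemma fanout_le_closed:
  fixes z :: "('x::finite, 'j::finite) fm set"
  assumes z: "z \<in> Omega" and v: "\<And>n. \<exists>v\<in>Omega. agree n z v \<and> fanout_le k b v"
  shows "fanout_le k b z"
  unfolding fanout_le_def
proof (intro allI impI)
  fix s j assume s: "(z, s) \<in> adj ^^ k"
  show "finite (poss j s) \<and> card (poss j s) \<le> b"
  proof (rule finite_if_finite_subsets_card_bdd)
    fix T assume T: "T \<subseteq> poss j s" "finite T"
    then have "T \<subseteq> Omega" using poss_Omega[of _ j s] by auto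
    then obtain n where n: "\<forall>u\<in>T. \<forall>w\<in>T. agree n u w \<longrightarrow> u = w"
      using separating_level[OF T(2)] by metis
    obtain v where v: "v \<in> Omega" "agree (Suc n + k) z v" "fanout_le k b v" using v by metis
    obtain t where t: "(v, t) \<in> adj ^^ k" "agree (Suc n) s t" "t \<in> Omega"
      using path_lifting[OF z v(1,2) s] by (elim exE conjE)
    have sO: "s \<in> Omega"
      using s cell_of_Omega[OF z, of s] by (auto simp: cell_of_ball)
    have "\<forall>u\<in>T. \<exists>w. w \<in> poss j t \<and> agree n u w"
    proof
      fix u assume "u \<in> T"
      then have u: "u \<in> Omega" "part j u = part j s" using T(1) by (auto simp: poss_def)
      obtain w where "w \<in> Omega" "part j w = part j t" "agree n u w"
        by (rule lifting[OF sO t(3,2) u])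
      then show "\<exists>w. w \<in> poss j t \<and> agree n u w" by (auto simp: poss_def)
    qed
    then obtain \<phi> where \<phi>: "\<forall>u\<in>T. \<phi> u \<in> poss j t \<and> agree n u (\<phi> u)" by (rule bchoice[THEN exE])
    have "inj_on \<phi> T"
    proof (rule inj_onI)
      fix u w assume "u \<in> T" "w \<in> T" "\<phi> u = \<phi> w"
      then have "agree n u w" using \<phi> agree_sym agree_trans by metis
      then show "u = w" using n \<open>u \<in> T\<close> \<open>w \<in> T\<close> by simp
    qed
    then have "card T = card (\<phi> ` T)" by (simp add: card_image)
    also have "\<dots> \<le> card (poss j t)"
      using v(3) t(1) \<phi> by (intro card_mono) (auto simp: fanout_le_def)
    also have "\<dots> \<le> b" using v(3) t(1) by (simp add: fanout_le_def)
    finally show "card T \<le> b" .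
  qed
qed

lemma fanout_le_exists:
  fixes f :: "('x::finite, 'j::finite) fm"
  assumes "admissible f z"
  shows "\<exists>b. fanout_le k b z"
proof -
  let ?S = "(\<lambda>(s, j). card (poss j s)) ` ((adj ^^ k) `` {z} \<times> UNIV)"
  have fin: "finite ?S" using admissible_ball(1)[OF assms] by simp
  have "fanout_le k (Max ?S) z"
    unfolding fanout_le_def
  proof (intro allI impI conjI)
    fix s j assume s: "(z, s) \<in> adj ^^ k"
    then show "card (poss j s) \<le> Max ?S" using fin by (intro Max_ge) auto
    show "finite (poss j s)" using s admissible_ball(2)[OF assms, of k] assms by (auto simp: admissible_def)
  qed
  then show ?thesis by (rule exI)
qed

text \<open>Quantifying over all \<open>v\<close> that agree with \<open>z\<close> makes this
  survive every later change beyond depth \<open>n\<close>, including the passage to the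
  limit.\<close>

definition hits :: "('x, 'j::finite) fm \<Rightarrow> ('x, 'j) fm \<Rightarrow> nat \<Rightarrow> ('x, 'j) fm set \<Rightarrow> bool" where
  "hits f g n z \<longleftrightarrow>
     (\<forall>v\<in>Omega. agree n z v \<longrightarrow> (\<exists>u\<in>Ck f. g \<in> u) \<longrightarrow> (\<exists>s\<in>cell_of v. g \<in> s))"

lemma hits_mono: "hits f g n z \<Longrightarrow> n \<le> m \<Longrightarrow> hits f g m z"
  unfolding hits_def using agree_mono by metis

text \<open>A path of length \<open>m\<close> to a state with \<open>g\<close> lifts to every state
  that agrees with \<open>z\<close> to depth \<open>depth g + m\<close>.\<close>

lemma hits_exists:
  fixes f :: "('x::finite, 'j::finite) fm"
  assumes "admissible f z"
  shows "\<exists>n. hits f g n z"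
proof (cases "\<exists>u\<in>Ck f. g \<in> u")
  case True
  then obtain s where s: "s \<in> cell_of z" "g \<in> s" using assms unfolding admissible_def dense_def by metis
  then obtain m where m: "(z, s) \<in> adj ^^ m" by (auto simp: cell_of_ball)
  have z: "z \<in> Omega" using assms Ck_Omega by (auto simp: admissible_def)
  have "hits f g (depth g + m) z"
    unfolding hits_def
  proof (intro ballI impI)
    fix v assume v: "v \<in> Omega" "agree (depth g + m) z v"
    obtain t where t: "(v, t) \<in> adj ^^ m" "agree (depth g) s t"
      using path_lifting[OF z v m] by (elim exE conjE)
    then have "g \<in> t" using agreeD[OF t(2)] s(2) by simp
    then show "\<exists>s\<in>cell_of v. g \<in> s" using t(1) by (auto simp: cell_of_ball)
  qed
  then show ?thesis by (rule exI)
next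
  case False
  then show ?thesis by (auto simp: hits_def)
qed

instance fm :: (countable, countable) countable
  by countable_datatype

text \<open>Each property of the limit is settled at some stage: the fanout at distance
  \<open>k\<close> by a bound at stage \<open>k\<close>, which all later stages keep, and the
  meeting of a formula right after the stage given by its code.\<close>

lemma admissible_limit:
  fixes f :: "('x::finite, 'j::finite) fm" and z :: "nat \<Rightarrow> ('x, 'j) fm set"
  assumes admissible: "\<And>k. admissible f (z k)"
    and N: "\<And>k. N k < N (Suc k)"
    and agr: "\<And>k. agree (N k) (z k) (z (Suc k))"
    and fanout_le: "\<And>k m b. m \<le> k \<Longrightarrow> fanout_le m b (z k) \<Longrightarrow> fanout_le m b (z (Suc k))"
    and hits: "\<And>k. hits f (from_nat k) (N (Suc k)) (z (Suc k))"
  shows "\<exists>Z. admissible f Z \<and> (\<forall>k. agree (N k) (z k) Z)"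
proof -
  have mono: "strict_mono N" using N by (rule strict_mono_Suc_iff[THEN iffD2, rule_format])
  then have Nk: "k \<le> N k" for k by (rule strict_mono_imp_increasing)
  have agr': "agree (N k) (z k) (z m)" if "k \<le> m" for k m
    using that
  proof (induction rule: dec_induct)
    case (step m)
    have "agree (N k) (z m) (z (Suc m))"
      using agree_mono[OF agr] strict_mono_leD[OF mono step(1)] by metis
    then show ?case using step.IH agree_trans by metis
  qed simp
  have fanout_le': "fanout_le k b (z m)" if "fanout_le k b (z k)" "k \<le> m" for k b m
    using that(2) by (induction rule: dec_induct) (use that(1) fanout_le in auto)
  \<comment> \<open>Stage \<open>depth g\<close> decides \<open>g\<close> for good, since
    \<open>k \<le> N k\<close>.\<close>
  define Z where "Z = {g. g \<in> z (depth g)}"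
  have Z: "agree (N k) (z k) Z" for k
    unfolding agree_def
  proof (intro allI impI)
    fix g :: "('x, 'j) fm" assume g: "depth g \<le> N k"
    have "g \<in> z k \<longleftrightarrow> g \<in> z (max k (depth g))"
      using agreeD[OF agr'[of k "max k (depth g)"] g] by simp
    also have "\<dots> \<longleftrightarrow> g \<in> z (depth g)"
      using agreeD[OF agr'[of "depth g" "max k (depth g)"] Nk] by simp
    finally show "g \<in> z k \<longleftrightarrow> g \<in> Z" by (simp add: Z_def)
  qed
  have zO: "z k \<in> Omega" and zC: "z k \<in> Ck f" for k
    using admissible[of k] Ck_Omega by (auto simp: admissible_def)
  have ZO: "Z \<in> Omega"
  proof -
    have "g \<in> Z \<or> Neg g \<in> Z" for g using zO by (simp add: Z_def)
    then have "complete_fms Z" unfolding complete_fms_def by (rule allI)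
    moreover have "consistent Z"
      unfolding consistent_def
    proof (rule notI, elim exE conjE)
      fix T g assume T: "finite T" "T \<subseteq> Z" "derives T g" "derives T (Neg g)"
      \<comment> \<open>One stage contains all of \<open>T\<close>, so a contradiction in the limit
        would be one in \<open>z k\<close>.\<close>
      define k where "k = Max (insert 0 (depth ` T))"
      have "h \<in> z k" if "h \<in> T" for h
      proof -
        have "depth h \<le> k" unfolding k_def using that T(1) by (intro Max_ge) auto
        then show ?thesis using agreeD[OF Z[of k], of h] Nk[of k] that T(2) by auto
      qed
      then have "T \<subseteq> z k" by auto
      then have "derives (z k) g" "derives (z k) (Neg g)" using T(3,4) derives_mono by metis+
      then show False using Omega_derives[OF zO] Omega_Neg[OF zO] by metis
    qed
    ultimately show ?thesis by (simp add: Omega_def)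
  qed
  have "(E ^^ m) f \<in> Z" for m using zC by (simp add: Z_def Ck_def)
  then have "Z \<in> Ck f" using ZO by (simp add: Ck_def)
  moreover have "dense f (cell_of Z)"
    unfolding dense_def
  proof (intro allI ballI impI)
    fix g u assume "u \<in> Ck f" "g \<in> u"
    then show "\<exists>s\<in>cell_of Z. g \<in> s"
      using hits[of "to_nat g"] Z[of "Suc (to_nat g)"] ZO unfolding hits_def by auto
  qed
  moreover have "finite (poss j s)" if "s \<in> cell_of Z" for s j
  proof -
    obtain k where k: "(Z, s) \<in> adj ^^ k" using \<open>s \<in> cell_of Z\<close> by (auto simp: cell_of_ball)
    obtain b where b: "fanout_le k b (z k)" using fanout_le_exists admissible by metis
    have "fanout_le k b Z"
    proof (rule fanout_le_closed[OF ZO])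
      fix n
      have "agree n Z (z (max n k))"
        using agree_mono[OF agree_sym[OF Z[of "max n k"]], of n] Nk[of "max n k"] by simp
      then show "\<exists>v\<in>Omega. agree n Z v \<and> fanout_le k b v"
        using zO fanout_le'[OF b, of "max n k"] by (intro bexI[of _ "z (max n k)"]) simp_all
    qed
    then show ?thesis using k by (simp add: fanout_le_def)
  qed
  ultimately show ?thesis using Z by (intro exI[of _ Z]) (simp add: admissible_def)
qed

text \<open>The depth \<open>n'\<close> has to tell the two branches apart and to secure
  \<open>g\<close> in both.\<close>

lemma split_admissible:
  fixes f :: "('x::finite, 'j::finite) fm"
  assumes "perfect f" "CARD('j) \<ge> 2" and z: "admissible f z"
  shows "\<exists>z' n'. admissible f z' \<and> agree n z z' \<and> (\<forall>m\<le>k. \<forall>b. fanout_le m b z \<longrightarrow> fanout_le m b z') \<and>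
    n < n' \<and> \<not> agree n' z z' \<and> hits f g n' z \<and> hits f g n' z'"
proof -
  obtain z' where z': "admissible f z'" "z' \<noteq> z" "agree n z z'" "\<forall>m\<le>k. \<forall>b. fanout_le m b z \<longrightarrow> fanout_le m b z'"
    using perturb[OF assms] by metis
  obtain n1 where n1: "\<not> agree n1 z z'"
    using not_agree_ex[of z z'] z'(1,2) z Ck_Omega unfolding admissible_def by metis
  obtain n2 n3 where n23: "hits f g n2 z" "hits f g n3 z'" using hits_exists z z'(1) by metis
  let ?n = "max (Suc n) (max n1 (max n2 n3))"
  have "n1 \<le> ?n" by simp
  then have "\<not> agree ?n z z'" using n1 agree_mono by metis
  moreover have "hits f g ?n z" "hits f g ?n z'" by (rule hits_mono[OF n23(1)] hits_mono[OF n23(2)]; simp)+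
  ultimately show ?thesis using z' by (intro exI[of _ z'] exI[of _ ?n]) simp
qed

lemma continuum_admissible:
  fixes f :: "('x::finite, 'j::finite) fm"
  assumes f: "perfect f" and J: "CARD('j) \<ge> 2" and z0: "admissible f z0"
  shows "\<exists>\<zeta> :: nat set \<Rightarrow> ('x, 'j) fm set. inj \<zeta> \<and> (\<forall>x. admissible f (\<zeta> x))"
proof -
  define P where "P k z n z' n' \<longleftrightarrow> admissible f z' \<and> agree n z z' \<and> (\<forall>m\<le>k. \<forall>b. fanout_le m b z \<longrightarrow> fanout_le m b z') \<and>
    n < n' \<and> \<not> agree n' z z' \<and> hits f (from_nat k) n' z \<and> hits f (from_nat k) n' z'" for k z n z' n'
  have "\<forall>k z n. \<exists>z' n'. admissible f z \<longrightarrow> P k z n z' n'"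
    using split_admissible[OF f J] unfolding P_def by metis
  then obtain \<phi> \<nu> where \<phi>: "\<And>k z n. admissible f z \<Longrightarrow> P k z n (\<phi> k z n) (\<nu> k z n)" by metis
  \<comment> \<open>The new depth does not depend on the branch taken, so two sets still share it at
    their first difference, where it separates their states and hence the limits.\<close>
  define st where "st x = rec_nat (z0, 0)
    (\<lambda>k (z, n). (if k \<in> x then \<phi> k z n else z, \<nu> k z n))" for x :: "nat set"
  define z N where "z x k = fst (st x k)" and "N x k = snd (st x k)" for x k
  have st_0: "z x 0 = z0" for x by (simp add: z_def st_def)
  have st_Suc: "z x (Suc k) = (if k \<in> x then \<phi> k (z x k) (N x k) else z x k)"
    "N x (Suc k) = \<nu> k (z x k) (N x k)" for x k
    by (simp_all add: z_def N_def st_def split: prod.splits)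
  have admissible: "admissible f (z x k)" for x k
    by (induction k) (use \<phi> z0 in \<open>auto simp: st_0 st_Suc P_def\<close>)
  have P: "P k (z x k) (N x k) (\<phi> k (z x k) (N x k)) (N x (Suc k))" for x k
    using \<phi>[OF admissible] by (simp add: st_Suc)
  have "\<exists>Z. admissible f Z \<and> (\<forall>k. agree (N x k) (z x k) Z)" for x
  proof (rule admissible_limit[OF admissible])
    fix k m b
    show "N x k < N x (Suc k)" using P[where x = x and k = k] by (simp add: P_def)
    show "agree (N x k) (z x k) (z x (Suc k))"
      using P[where x = x and k = k] by (simp add: P_def st_Suc(1))
    show "fanout_le m b (z x (Suc k))" if "m \<le> k" "fanout_le m b (z x k)"
      using P[where x = x and k = k] that by (simp add: P_def st_Suc(1))
    show "hits f (from_nat k) (N x (Suc k)) (z x (Suc k))"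
      using P[where x = x and k = k] by (simp add: P_def st_Suc(1))
  qed
  then obtain \<zeta> where \<zeta>: "\<And>x. admissible f (\<zeta> x)" "\<And>x k. agree (N x k) (z x k) (\<zeta> x)" by metis
  have neq: "\<zeta> x \<noteq> \<zeta> x'" if k: "\<And>m. m < k \<Longrightarrow> m \<in> x \<longleftrightarrow> m \<in> x'" "k \<in> x" "k \<notin> x'" for k x x'
  proof
    assume eq: "\<zeta> x = \<zeta> x'"
    have "m \<le> k \<Longrightarrow> st x m = st x' m" for m
      by (induction m) (simp_all add: st_def k(1))
    then have zN: "z x k = z x' k" "N x k = N x' k" by (simp_all add: z_def N_def)
    then have NS: "N x (Suc k) = N x' (Suc k)" by (simp add: st_Suc)
    have "agree (N x (Suc k)) (\<phi> k (z x k) (N x k)) (\<zeta> x)"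
      using \<zeta>(2)[of x "Suc k"] k(2) by (simp add: st_Suc)
    moreover have "agree (N x (Suc k)) (z x k) (\<zeta> x)"
      using \<zeta>(2)[of x' "Suc k"] k(3) zN NS eq by (simp add: st_Suc(1))
    ultimately have "agree (N x (Suc k)) (z x k) (\<phi> k (z x k) (N x k))"
      using agree_sym agree_trans by metis
    then show False using P[of k x] by (simp add: P_def)
  qed
  have "inj \<zeta>"
  proof (rule injI, rule ccontr)
    fix x x' assume eq: "\<zeta> x = \<zeta> x'" and "x \<noteq> x'"
    then have ex: "\<exists>k. (k \<in> x) \<noteq> (k \<in> x')" by auto
    define k where "k = (LEAST k. (k \<in> x) \<noteq> (k \<in> x'))"
    have k: "(k \<in> x) \<noteq> (k \<in> x')" unfolding k_def using ex by (rule LeastI_ex)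
    have "m \<in> x \<longleftrightarrow> m \<in> x'" if "m < k" for m
      using not_less_Least[OF that[unfolded k_def]] by simp
    then show False using neq[of k x x'] neq[of k x' x] k eq by metis
  qed
  then show ?thesis using \<zeta>(1) by (intro exI[of _ \<zeta>]) simp
qed

section \<open>The number of cells\<close>

text \<open>A finite family of countable sets has a countable union, so the family is infinite, and
  then its union has no more points than the family has members.\<close>

lemma uncountable_lepoll_countable_classes:
  assumes "uncountable A" and countable: "\<And>B. B \<in> \<B> \<Longrightarrow> countable B" and cover: "A \<subseteq> \<Union>\<B>"
  shows "A \<lesssim> \<B>"
proof -
  have "infinite \<B>"
  proof
    assume "finite \<B>"
    then have "countable (\<Union>B\<in>\<B>. B)" using \<open>finite \<B>\<close> countable
      by (intro countable_UN[OF countable_finite])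
    then show False using assms(1) countable_subset[of A] cover by simp
  qed
  then have \<B>: "(card_of (UNIV :: nat set), card_of \<B>) \<in> ordLeq"
    by (simp add: infinite_iff_card_of_nat)
  have "(card_of B, card_of \<B>) \<in> ordLeq" if B: "B \<in> \<B>" for B
  proof -
    obtain g :: "'a \<Rightarrow> nat" where "inj_on g B" using countable[OF B] unfolding countable_def by auto
    then have "(card_of B, card_of (UNIV :: nat set)) \<in> ordLeq"
      using card_of_ordLeq[of B "UNIV :: nat set"] by auto
    then show ?thesis using \<B> by (rule ordLeq_transitive)
  qed
  then have "(card_of (\<Union>B\<in>\<B>. B), card_of \<B>) \<in> ordLeq"
    by (intro card_of_UNION_ordLeq_infinite[OF \<open>infinite \<B>\<close>]) (simp_all add: card_of_mono1)
  moreover have "(card_of A, card_of (\<Union>B\<in>\<B>. B)) \<in> ordLeq" using cover by (intro card_of_mono1) simp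
  ultimately have "(card_of A, card_of \<B>) \<in> ordLeq" using ordLeq_transitive by metis
  then show ?thesis by (simp add: lepoll_def card_of_ordLeq)
qed

theorem theorem2:
  fixes f :: "('x::finite, 'j::finite) fm"
  assumes "generative f"
  shows "{C. cell C \<and> finite_fanout C \<and> dense_in_Ck C f} \<approx> (UNIV :: real set)"
proof (rule lepoll_antisym)
  let ?S = "{C :: ('x, 'j) fm set set. cell C \<and> finite_fanout C \<and> dense_in_Ck C f}"
  \<comment> \<open>Cells are disjoint, so a chosen member determines its cell, and there are no
    more cells than sets of formulas.\<close>
  have "inj_on (\<lambda>C. SOME z. z \<in> C) ?S"
  proof (rule inj_onI)
    fix C D assume C: "C \<in> ?S" and D: "D \<in> ?S" and eq: "(SOME z. z \<in> C) = (SOME z. z \<in> D)"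
    have some: "(SOME z. z \<in> B) \<in> B" if "B \<in> ?S" for B using that by (simp add: cell_def some_in_eq)
    show "C = D" using cell_eq_cell_of some[OF C] some[OF D] C D eq by (metis (lifting) mem_Collect_eq)
  qed
  then have "?S \<lesssim> (UNIV :: ('x, 'j) fm set set)" by (auto simp: lepoll_def)
  also have "(UNIV :: ('x, 'j) fm set set) \<lesssim> (UNIV :: nat set set)"
    unfolding lepoll_def
    by (rule exI[of _ "image to_nat"]) (simp add: inj_on_def inj_image_eq_iff)
  also have "(UNIV :: nat set set) \<approx> (UNIV :: real set)" by (rule nat_sets_eqpoll_reals)
  finally show "?S \<lesssim> (UNIV :: real set)" .

  obtain C C' where C: "cell C" "cell C'" "C \<noteq> C'" "dense_in_Ck C f" "dense_in_Ck C' f"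
    and J: "CARD('j) \<ge> 2" using assms unfolding generative_def by metis
  then have f: "perfect f" unfolding perfect_def using no_isolated_point by metis
  obtain c where c: "c \<in> C" using C(1) by (auto simp: cell_def)
  then have cC: "C = cell_of c" by (rule cell_eq_cell_of[OF C(1)])
  \<comment> \<open>\<open>undefined\<close> is merely some agent; a second one is wanted.\<close>
  obtain i :: 'j where il: "undefined \<noteq> i" by (rule other_agent[OF J])
  interpret chain f c i
    by standard (use c C(4) in \<open>auto simp: dense_in_Ck_iff\<close>)
  have "dense f (cell_of c)" using C(4) cC by (simp add: dense_in_Ck_iff)
  then obtain z0 where z0: "admissible f z0" using dense_finite_cell[OF il] unfolding admissible_def by metis
  obtain \<zeta> :: "nat set \<Rightarrow> ('x, 'j) fm set" where \<zeta>: "inj \<zeta>" "\<And>x. admissible f (\<zeta> x)"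
    using continuum_admissible[OF f J z0] by metis
  have \<zeta>O: "\<zeta> x \<in> Omega" for x using \<zeta>(2) Ck_Omega unfolding admissible_def by metis
  have "(UNIV :: real set) \<lesssim> (UNIV :: nat set set)"
    using nat_sets_eqpoll_reals eqpoll_imp_lepoll eqpoll_sym by metis
  also have "(UNIV :: nat set set) \<lesssim> range \<zeta>" using \<zeta>(1) by (auto simp: lepoll_def)
  finally have R: "(UNIV :: real set) \<lesssim> range \<zeta>" .
  have "range \<zeta> \<lesssim> (\<lambda>x. cell_of (\<zeta> x)) ` UNIV"
  proof (rule uncountable_lepoll_countable_classes)
    show "uncountable (range \<zeta>)"
      using R uncountable_UNIV_real countable_lepoll by metis
    show "countable B" if "B \<in> (\<lambda>x. cell_of (\<zeta> x)) ` UNIV" for B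
      using that countable_cell_of[OF \<zeta>O] \<zeta>(2) by (auto simp: admissible_def)
    show "range \<zeta> \<subseteq> \<Union> (range (\<lambda>x. cell_of (\<zeta> x)))" by auto
  qed
  also have "(\<lambda>x. cell_of (\<zeta> x)) ` UNIV \<lesssim> ?S"
  proof (rule subset_imp_lepoll, rule subsetI)
    fix B assume "B \<in> range (\<lambda>x. cell_of (\<zeta> x))"
    then obtain x where x: "B = cell_of (\<zeta> x)" by auto
    have "finite_fanout B" unfolding x by (rule finite_fanoutI) (use \<zeta>(2) in \<open>simp add: admissible_def\<close>)
    moreover have "dense_in_Ck B f"
      unfolding x dense_in_Ck_iff using \<zeta>(2)[of x] Ck_cell_of by (auto simp: admissible_def)
    ultimately show "B \<in> ?S" using cell_cell_of[OF \<zeta>O] x by simp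
  qed
  finally have "range \<zeta> \<lesssim> ?S" .
  with R show "(UNIV :: real set) \<lesssim> ?S" by (rule lepoll_trans)
qed

end
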